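(* Let $m$ be a positive integer, let $x_0,\dots,x_N\in[0,1]$ be nodes and $C_0,\dots,C_N$ real coefficients, and let $$\ell(x)=\varepsilon_{[0,1]}(x)-\sum_{\beta=0}^N C_\beta\,\delta(x-x_\beta)$$ be the error functional of the quadrature formula $\int_0^1\varphi(x)\,dx\cong\sum_{\beta=0}^N C_\beta\varphi(x_\beta)$. Let $\psi_\ell$ be a solution (derivatives in the generalized sense) of the boundary value problem $$\psi_\ell^{(2m)}(x)-\psi_\ell^{(2m-2)}(x)=(-1)^m\ell(x),$$ $$\left(\psi_\ell^{(m+s)}(x)-\psi_\ell^{(m+s-2)}(x)\right)\Big|_{x=0}^{x=1}=0,\quad s=1,2,\dots,m-1,$$ $$\left(\psi_\ell^{(m)}(x)+\psi_\ell^{(m-1)}(x)\right)\Big|_{x=0}^{x=1}=0.$$ Then $\psi_\ell$ is the extremal function of the error functional $\ell$, and it has the form $$\psi_\ell(x)=(-1)^m\,\ell(x)*G(x)+P_{m-2}(x)+d\,e^{-x},$$ where $$G(x)=\frac{\operatorname{sign}x}{2}\left(\frac{e^x-e^{-x}}{2}-\sum_{k=1}^{m-1}\frac{x^{2k-1}}{(2k-1)!}\right)$$ is a solution of the equation $\psi^{(2m)}(x)-\psi^{(2m-2)}(x)=\delta(x)$, $d$ is a real number, and $P_{m-2}$ is a polynomial of degree $m-2$.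
   Context: $\varepsilon_{[0,1]}$ is the indicator function of $[0,1]$ and $\delta$ is the Dirac delta function. $W_2^{(m,m-1)}(0,1)$ denotes the Hilbert space of functions on $(0,1)$ equipped with the inner product $\langle\psi,\varphi\rangle=\int_0^1(\psi^{(m)}(x)+\psi^{(m-1)}(x))(\varphi^{(m)}(x)+\varphi^{(m-1)}(x))\,dx$ and norm $\|\varphi|W_2^{(m,m-1)}(0,1)\|=\left(\int_0^1(\varphi^{(m)}(x)+\varphi^{(m-1)}(x))^2dx\right)^{1/2}$. The action of $\ell$ on $\varphi$ is $(\ell,\varphi)=\int_0^1\varphi(x)dx-\sum_\beta C_\beta\varphi(x_\beta)$, and its norm in the dual space is $\|\ell|W_2^{(m,m-1)*}(0,1)\|=\sup_{\|\varphi|W_2^{(m,m-1)}(0,1)\|=1}|(\ell,\varphi)|$. A function $\psi_\ell\in W_2^{(m,m-1)}(0,1)$ is called the extremal function of $\ell$ if $(\ell,\psi_\ell)=\|\ell|W_2^{(m,m-1)*}(0,1)\|\cdot\|\psi_\ell|W_2^{(m,m-1)}(0,1)\|$. Convolution is $f*g(x)=\int_{-\infty}^{\infty}f(y)g(x-y)dy$; in particular $\ell*G(x)=\int_0^1G(x-y)dy-\sum_\beta C_\beta G(x-x_\beta)$. *)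

theory Defs
  imports "HOL-Analysis.Analysis" "HOL-Computational_Algebra.Polynomial"
begin

definition test_fn :: "(real \<Rightarrow> real) \<Rightarrow> bool" where
  "test_fn \<phi> \<longleftrightarrow> (\<forall>k x. ((deriv ^^ k) \<phi>) differentiable (at x))
                  \<and> (\<exists>R. \<forall>x. R < \<bar>x\<bar> \<longrightarrow> \<phi> x = 0)"

definition ell_act :: "nat \<Rightarrow> (nat \<Rightarrow> real) \<Rightarrow> (nat \<Rightarrow> real) \<Rightarrow> (real \<Rightarrow> real) \<Rightarrow> real" where
  "ell_act N C xs \<phi> = (LINT t:{0..1}|lborel. \<phi> t) - (\<Sum>\<beta>=0..N. C \<beta> * \<phi> (xs \<beta>))"

definition G :: "nat \<Rightarrow> real \<Rightarrow> real" where
  "G m x = sgn x / 2 * ((exp x - exp (- x)) / 2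
             - (\<Sum>k=1..m-1. x ^ (2*k - 1) / fact (2*k - 1)))"

definition ell_conv_G :: "nat \<Rightarrow> nat \<Rightarrow> (nat \<Rightarrow> real) \<Rightarrow> (nat \<Rightarrow> real) \<Rightarrow> real \<Rightarrow> real" where
  "ell_conv_G m N C xs x =
     (LINT y:{0..1}|lborel. G m (x - y)) - (\<Sum>\<beta>=0..N. C \<beta> * G m (x - xs \<beta>))"

text \<open>Distributional equation  u^(2m) - u^(2m-2) = T  on the real line, where the
  distribution T is given by its action on test functions.\<close>
definition dist_solves :: "nat \<Rightarrow> (real \<Rightarrow> real) \<Rightarrow> ((real \<Rightarrow> real) \<Rightarrow> real) \<Rightarrow> bool" where
  "dist_solves m u T \<longleftrightarrow>
     (\<forall>\<phi>. test_fn \<phi> \<longrightarrow>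
        (\<lambda>t. u t * ((deriv ^^ (2*m)) \<phi> t - (deriv ^^ (2*m - 2)) \<phi> t)) \<in> borel_measurable lborel
        \<and> integrable lborel (\<lambda>t. u t * ((deriv ^^ (2*m)) \<phi> t - (deriv ^^ (2*m - 2)) \<phi> t))
        \<and> (LINT t|lborel. u t * ((deriv ^^ (2*m)) \<phi> t - (deriv ^^ (2*m - 2)) \<phi> t)) = T \<phi>)"

text \<open>g k plays the role of the k-th derivative of phi on [0,1]: g 0 = phi, each g k (k < m)
  is the indefinite integral of g (k+1), and g m is square integrable on [0,1].\<close>
definition W_derivs :: "nat \<Rightarrow> (real \<Rightarrow> real) \<Rightarrow> (nat \<Rightarrow> real \<Rightarrow> real) \<Rightarrow> bool" where
  "W_derivs m \<phi> g \<longleftrightarrow>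
     (\<forall>x\<in>{0..1}. g 0 x = \<phi> x)
     \<and> (\<forall>k<m. set_integrable lborel {0..1} (g (Suc k))
              \<and> (\<forall>x\<in>{0..1}. g k x = g k 0 + (LINT t:{0..x}|lborel. g (Suc k) t)))
     \<and> set_integrable lborel {0..1} (\<lambda>t. (g m t)\<^sup>2)"

definition in_W :: "nat \<Rightarrow> (real \<Rightarrow> real) \<Rightarrow> bool" where
  "in_W m \<phi> \<longleftrightarrow> (\<exists>g. W_derivs m \<phi> g)"

definition W_norm :: "nat \<Rightarrow> (real \<Rightarrow> real) \<Rightarrow> real" where
  "W_norm m \<phi> = (let g = (SOME g. W_derivs m \<phi> g) in
      sqrt (LINT t:{0..1}|lborel. (g m t + g (m - 1) t)\<^sup>2))"

definition ell_norm :: "nat \<Rightarrow> nat \<Rightarrow> (nat \<Rightarrow> real) \<Rightarrow> (nat \<Rightarrow> real) \<Rightarrow> ereal" where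
  "ell_norm m N C xs = (SUP \<phi>\<in>{\<phi>. in_W m \<phi> \<and> W_norm m \<phi> = 1}. ereal \<bar>ell_act N C xs \<phi>\<bar>)"

definition extremal_fn :: "nat \<Rightarrow> nat \<Rightarrow> (nat \<Rightarrow> real) \<Rightarrow> (nat \<Rightarrow> real) \<Rightarrow> (real \<Rightarrow> real) \<Rightarrow> bool" where
  "extremal_fn m N C xs \<psi> \<longleftrightarrow>
     in_W m \<psi> \<and> ereal (ell_act N C xs \<psi>) = ell_norm m N C xs * ereal (W_norm m \<psi>)"

text \<open>Boundary condition: the k-th derivative combination vanishes at x = 0 and x = 1,
  taking (generalized) derivatives as one-sided limits from outside [0,1].\<close>
definition vanishes_at_ends :: "(real \<Rightarrow> real) \<Rightarrow> bool" where
  "vanishes_at_ends f \<longleftrightarrow> (f \<longlongrightarrow> 0) (at_left 0) \<and> (f \<longlongrightarrow> 0) (at_right 1)"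

end

theory Submission
  imports Defs
begin

text \<open>By du Bois-Reymond type arguments the difference of \<open>\<psi>\<close> and \<open>(-1)\<^sup>m \<ell> * G\<close> is
  \<open>p(x) + a e\<^sup>x + b e\<^sup>-\<^sup>x\<close> with \<open>deg p < 2m - 2\<close>. Outside \<open>[0,1]\<close> the function \<open>\<ell> * G\<close> is plus or minus
  one and the same combination of translates of smooth functions, so the boundary conditions at \<open>0\<close>
  and at \<open>1\<close> hold for both signs; hence they force \<open>deg p < m - 1\<close>, \<open>a = 0\<close>, and that \<open>\<ell>\<close> vanishes on
  \<open>1, x, \<dots>, x\<^sup>m\<^sup>-\<^sup>2, e\<^sup>-\<^sup>x\<close>. This makes \<open>\<ell>(\<phi>)\<close> equal to the integral of a Peano kernel against
  \<open>\<phi>\<^sup>(\<^sup>m\<^sup>) + \<phi>\<^sup>(\<^sup>m\<^sup>-\<^sup>1\<^sup>)\<close>, and that kernel is \<open>\<psi>\<^sup>(\<^sup>m\<^sup>) + \<psi>\<^sup>(\<^sup>m\<^sup>-\<^sup>1\<^sup>)\<close> almost everywhere. So \<open>\<psi>\<close> is the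
  Riesz representer of \<open>\<ell>\<close>, and extremality is the equality case of Cauchy-Schwarz.\<close>

section \<open>Smooth functions and test functions\<close>

text \<open>All explicit formulas live on ladders of functions, each entry being the derivative of
  the next (away from 0 for \<open>sgn_tail\<close>): \<open>htail\<close>, \<open>sgn_tail\<close>,
  \<open>mono_fact\<close>, \<open>exp_tail\<close>, \<open>kern\<close>. Integration over [0,1]
  moves one rung up, so convolutions with the error functional and their derivatives remain
  explicit. Two identities do the work. The difference \<open>htail n x - htail (n + 2) x\<close> is
  x^n/n!, so D^2 - 1, the operator of the first boundary conditions, leaves only polynomials. The
  sum \<open>htail (Suc n) x + htail n x\<close> is a Taylor remainder of exp, so D + 1, the
  operator of the last boundary condition and of the norm, leaves a multiple of e^x once the moments
  of the functional vanish. The obstacle is low regularity: for m = 1 the derivative of order m of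
  \<psi> may jump at the nodes, and for a general function of the space it is only square
  integrable. Hence derivatives are compared almost everywhere, and integration by parts is replaced
  by an exchange of the order of integration.\<close>

definition smooth :: "(real \<Rightarrow> real) \<Rightarrow> bool" where
  "smooth f \<longleftrightarrow> (\<forall>k x. ((deriv ^^ k) f) differentiable (at x))"

lemma real_differentiableI: "(f has_real_derivative D) (at x) \<Longrightarrow> f differentiable (at x)"
  by (auto simp: real_differentiable_def)

text \<open>A set of differentiable functions closed under \<open>deriv\<close> contains every
  iterated derivative. Each smoothness proof below thereby reduces to guessing a closed set.\<close>

lemma smooth_coinduct:
  assumes "f \<in> S" and "\<And>g x. g \<in> S \<Longrightarrow> g differentiable (at x)"
    and "\<And>g. g \<in> S \<Longrightarrow> deriv g \<in> S"
  shows "smooth f"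
proof -
  have "(deriv ^^ k) f \<in> S" for k
    by (induction k) (use assms in auto)
  then show ?thesis using assms(2) by (auto simp: smooth_def)
qed

lemma smooth_imp_DERIV: "smooth f \<Longrightarrow> (f has_real_derivative deriv f x) (at x)"
  using DERIV_deriv_iff_real_differentiable unfolding smooth_def
  by (metis funpow_0)

lemma smooth_imp_continuous_on: "smooth f \<Longrightarrow> continuous_on A f"
  by (meson DERIV_continuous continuous_at_imp_continuous_on smooth_imp_DERIV)

lemma smooth_deriv: "smooth f \<Longrightarrow> smooth (deriv f)"
  unfolding smooth_def by (metis comp_apply funpow_Suc_right)

lemma smooth_funpow_deriv: "smooth f \<Longrightarrow> smooth ((deriv ^^ k) f)"
  by (induction k) (auto intro: smooth_deriv)

lemma smooth_const: "smooth (\<lambda>x. c)"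
  by (rule smooth_coinduct[where S = "range (\<lambda>c x. c)"]) auto

lemma deriv_add_smooth: "smooth f \<Longrightarrow> smooth g \<Longrightarrow> deriv (\<lambda>x. f x + g x) = (\<lambda>x. deriv f x + deriv g x)"
  by (intro ext DERIV_imp_deriv) (auto intro!: derivative_intros smooth_imp_DERIV)

lemma deriv_cmult_smooth: "smooth f \<Longrightarrow> deriv (\<lambda>x. c * f x) = (\<lambda>x. c * deriv f x)"
  by (intro ext DERIV_imp_deriv) (auto intro!: derivative_eq_intros smooth_imp_DERIV)

lemma smooth_add:
  assumes "smooth f" "smooth g" shows "smooth (\<lambda>x. f x + g x)"
proof (rule smooth_coinduct[where S = "{\<lambda>x. f x + g x |f g. smooth f \<and> smooth g}"])
  fix h x assume "h \<in> {\<lambda>x. f x + g x |f g. smooth f \<and> smooth g}"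
  then obtain f g where h: "h = (\<lambda>x. f x + g x)" "smooth f" "smooth g" by blast
  have "(h has_real_derivative deriv f x + deriv g x) (at x)" unfolding h(1)
    by (intro derivative_intros smooth_imp_DERIV h)
  then show "h differentiable at x" by (rule real_differentiableI)
next
  fix h assume "h \<in> {\<lambda>x. f x + g x |f g. smooth f \<and> smooth g}"
  then obtain f g where h: "h = (\<lambda>x. f x + g x)" "smooth f" "smooth g" by blast
  show "deriv h \<in> {\<lambda>x. f x + g x |f g. smooth f \<and> smooth g}"
    unfolding h deriv_add_smooth[OF h(2,3)] using h smooth_deriv by blast
qed (use assms in blast)

text \<open>The Leibniz rule turns one product into a sum of two, so products alone are not closed
  under \<open>deriv\<close>; their finite sums are.\<close>

inductive_set prod_sums :: "(real \<Rightarrow> real) set" where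
  prod: "smooth f \<Longrightarrow> smooth g \<Longrightarrow> (\<lambda>x. f x * g x) \<in> prod_sums"
| sum: "h \<in> prod_sums \<Longrightarrow> k \<in> prod_sums \<Longrightarrow> (\<lambda>x. h x + k x) \<in> prod_sums"

lemma prod_sums_deriv:
  "h \<in> prod_sums \<Longrightarrow> (\<forall>x. h differentiable at x) \<and> deriv h \<in> prod_sums"
proof (induction rule: prod_sums.induct)
  case (prod f g)
  have D: "((\<lambda>x. f x * g x) has_real_derivative (deriv f x * g x + f x * deriv g x)) (at x)" for x
    by (auto intro!: derivative_eq_intros smooth_imp_DERIV prod)
  have "deriv (\<lambda>x. f x * g x) = (\<lambda>x. deriv f x * g x + f x * deriv g x)"
    by (intro ext DERIV_imp_deriv D)
  moreover have "(\<lambda>x. deriv f x * g x + f x * deriv g x) \<in> prod_sums"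
    by (intro prod_sums.intros smooth_deriv prod)
  ultimately show ?case using D real_differentiableI by metis
next
  case (sum h k)
  have D: "((\<lambda>x. h x + k x) has_real_derivative (deriv h x + deriv k x)) (at x)" for x
    using sum by (auto intro!: derivative_intros simp: DERIV_deriv_iff_real_differentiable)
  have "deriv (\<lambda>x. h x + k x) = (\<lambda>x. deriv h x + deriv k x)"
    by (intro ext DERIV_imp_deriv D)
  moreover have "(\<lambda>x. deriv h x + deriv k x) \<in> prod_sums"
    using sum by (intro prod_sums.intros) auto
  ultimately show ?case using D real_differentiableI by metis
qed

lemma smooth_mult: "smooth f \<Longrightarrow> smooth g \<Longrightarrow> smooth (\<lambda>x. f x * g x)"
  by (rule smooth_coinduct[where S = prod_sums]) (auto dest: prod_sums_deriv intro: prod_sums.prod)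

lemma smooth_cmult: "smooth f \<Longrightarrow> smooth (\<lambda>x. c * f x)"
  by (intro smooth_mult smooth_const)

text \<open>The equation f' = c f + g keeps the functions a f + s with s smooth closed under
  \<open>deriv\<close>. It serves the antiderivative of a test function, which is known only through
  such an equation.\<close>

lemma smooth_ode:
  assumes D: "\<And>x. (f has_real_derivative c * f x + g x) (at x)" and g: "smooth g"
  shows "smooth f"
proof (rule smooth_coinduct[where S = "{\<lambda>x. a * f x + s x |a s. smooth s}"])
  have "f = (\<lambda>x. 1 * f x + 0)" by simp
  moreover have "smooth (\<lambda>x. 0)" by (rule smooth_const)
  ultimately show "f \<in> {\<lambda>x. a * f x + s x |a s. smooth s}" by fast
next
  fix h assume "h \<in> {\<lambda>x. a * f x + s x |a s. smooth s}"
  then obtain a s where h: "h = (\<lambda>x. a * f x + s x)" and s: "smooth s" by blast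
  have D': "(h has_real_derivative (a * c) * f x + (a * g x + deriv s x)) (at x)" for x
    unfolding h by (auto intro!: derivative_eq_intros D smooth_imp_DERIV s simp: algebra_simps)
  then show "h differentiable at x" for x using real_differentiableI by blast
  have "deriv h = (\<lambda>x. (a * c) * f x + (a * g x + deriv s x))"
    by (intro ext DERIV_imp_deriv D')
  moreover have "smooth (\<lambda>x. a * g x + deriv s x)"
    by (intro smooth_add smooth_cmult smooth_deriv g s)
  ultimately show "deriv h \<in> {\<lambda>x. a * f x + s x |a s. smooth s}" by fast
qed

lemma smooth_affine:
  assumes "smooth f" shows "smooth (\<lambda>x. f (a * x + b))"
proof (rule smooth_coinduct[where S = "{\<lambda>x. c * g (a * x + b) |c g. smooth g}"])
  have "(\<lambda>x. f (a * x + b)) = (\<lambda>x. 1 * f (a * x + b))" by simp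
  then show "(\<lambda>x. f (a * x + b)) \<in> {\<lambda>x. c * g (a * x + b) |c g. smooth g}"
    using assms by blast
next
  fix h assume "h \<in> {\<lambda>x. c * g (a * x + b) |c g. smooth g}"
  then obtain c g where h: "h = (\<lambda>x. c * g (a * x + b))" and g: "smooth g" by blast
  have D: "(h has_real_derivative (c * a) * deriv g (a * x + b)) (at x)" for x
    unfolding h
    by (auto intro!: derivative_eq_intros DERIV_chain'[OF _ smooth_imp_DERIV[OF g]])
  then show "h differentiable at x" for x using real_differentiableI by blast
  have "deriv h = (\<lambda>x. (c * a) * deriv g (a * x + b))"
    by (intro ext DERIV_imp_deriv D)
  then show "deriv h \<in> {\<lambda>x. c * g (a * x + b) |c g. smooth g}"
    using smooth_deriv[OF g] by blast
qed

text \<open>The case \<open>p = 1\<close> is the usual flat function; admitting a polynomial makes the family closed under derivatives.\<close>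
definition flat :: "real poly \<Rightarrow> real \<Rightarrow> real" where
  "flat p x = (if x > 0 then poly p (1 / x) * exp (- (1 / x)) else 0)"

lemma poly_exp_decay: "((\<lambda>y. poly p y * exp (- y)) \<longlongrightarrow> 0) (at_top :: real filter)"
proof -
  have "((\<lambda>y::real. \<Sum>i\<le>degree p. coeff p i * (y ^ i / exp y)) \<longlongrightarrow> (\<Sum>i\<le>degree p. coeff p i * 0)) at_top"
    by (intro tendsto_intros tendsto_power_div_exp_0)
  then show ?thesis
    by (simp add: poly_altdef sum_distrib_right exp_minus divide_inverse mult.assoc)
qed

lemma flat_tendsto_0: "(flat p \<longlongrightarrow> 0) (at 0)"
proof -
  have "((\<lambda>x. poly p (inverse x) * exp (- inverse x)) \<longlongrightarrow> 0) (at_right (0::real))"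
    by (rule filterlim_compose[OF poly_exp_decay filterlim_inverse_at_top_right])
  then have "(flat p \<longlongrightarrow> 0) (at_right 0)"
    by (rule tendsto_cong[THEN iffD1, rotated])
      (auto simp: flat_def eventually_at_filter inverse_eq_divide)
  moreover have "(flat p \<longlongrightarrow> 0) (at_left 0)"
    by (rule tendsto_eventually) (auto simp: flat_def eventually_at_filter)
  ultimately show ?thesis by (simp add: filterlim_split_at)
qed

text \<open>With y = 1/x one has d/dx = - y^2 d/dy, and this takes p(y) e^(-y) to y^2 (p - p')(y)
  e^(-y); the factor \<open>[:0, 0, 1:]\<close> is y^2.\<close>

lemma flat_DERIV:
  "(flat p has_real_derivative flat ([:0, 0, 1:] * (p - pderiv p)) x) (at x)"
proof -
  consider "x > 0" | "x < 0" | "x = 0" by linarith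
  then show ?thesis
  proof cases
    case 1
    have "((\<lambda>x. poly p (1 / x) * exp (- (1 / x))) has_real_derivative
       flat ([:0, 0, 1:] * (p - pderiv p)) x) (at x)"
      using 1 unfolding flat_def
      by (auto intro!: derivative_eq_intros DERIV_chain'[OF _ poly_DERIV]
          simp: field_simps power2_eq_square)
    then show ?thesis
      by (rule has_field_derivative_transform_within_open[where S = "{0<..}"])
        (use 1 in \<open>auto simp: flat_def\<close>)
  next
    case 2
    have "((\<lambda>x. 0) has_real_derivative flat ([:0, 0, 1:] * (p - pderiv p)) x) (at x)"
      using 2 by (simp add: flat_def)
    then show ?thesis
      by (rule has_field_derivative_transform_within_open[where S = "{..<0}"])
        (use 2 in \<open>auto simp: flat_def\<close>)
  next
    case 3
    \<comment> \<open>Division by h multiplies the polynomial by y = 1/h, so the difference quotient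
      at 0 is again of the form \<open>flat\<close> and tends to 0.\<close>
    have "(flat p (0 + h) - flat p 0) / h = flat ([:0, 1:] * p) h" for h
      by (simp add: flat_def)
    moreover have "flat ([:0, 0, 1:] * (p - pderiv p)) 0 = 0"
      by (simp add: flat_def)
    ultimately show ?thesis
      using 3 flat_tendsto_0[of "[:0, 1:] * p"] by (simp only: DERIV_def)
  qed
qed

lemma smooth_flat: "smooth (flat p)"
proof (rule smooth_coinduct[where S = "range flat"])
  fix h assume "h \<in> range flat"
  then obtain q where q: "h = flat q" by blast
  show "h differentiable at x" for x
    unfolding q using flat_DERIV real_differentiableI by blast
  have "deriv h = flat ([:0, 0, 1:] * (q - pderiv q))"
    unfolding q by (intro ext DERIV_imp_deriv flat_DERIV)
  then show "deriv h \<in> range flat" by blast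
qed blast

section \<open>Test functions: support, closure properties, bumps\<close>

lemma test_fn_iff: "test_fn \<phi> \<longleftrightarrow> smooth \<phi> \<and> (\<exists>R. \<forall>x. R < \<bar>x\<bar> \<longrightarrow> \<phi> x = 0)"
  by (simp add: test_fn_def smooth_def)

lemma test_fn_smooth: "test_fn \<phi> \<Longrightarrow> smooth \<phi>"
  by (simp add: test_fn_iff)

text \<open>The non-strict \<open>R \<le> \<bar>x\<bar>\<close> gives zeros at the endpoints R and
  -R themselves, which removes boundary terms; \<open>B\<close> allows R to be taken beyond a given
  point.\<close>

lemma test_fn_support:
  assumes "test_fn \<phi>" obtains R where "R > B" "R > 0" "\<And>x. R \<le> \<bar>x\<bar> \<Longrightarrow> \<phi> x = 0"
proof -
  obtain R where R: "\<forall>x. R < \<bar>x\<bar> \<longrightarrow> \<phi> x = 0" using assms by (auto simp: test_fn_iff)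
  show ?thesis
    by (rule that[of "\<bar>R\<bar> + \<bar>B\<bar> + 1"]) (use R in auto)
qed

lemma test_fn_lincomb:
  assumes "test_fn f" "test_fn g" shows "test_fn (\<lambda>x. f x + c * g x)"
proof -
  obtain R where "\<And>x. R \<le> \<bar>x\<bar> \<Longrightarrow> f x = 0"
    using test_fn_support[OF assms(1)] by metis
  moreover obtain R' where "\<And>x. R' \<le> \<bar>x\<bar> \<Longrightarrow> g x = 0"
    using test_fn_support[OF assms(2)] by metis
  ultimately have "\<forall>x. max R R' < \<bar>x\<bar> \<longrightarrow> f x + c * g x = 0" by auto
  moreover have "smooth (\<lambda>x. f x + c * g x)"
    using assms by (intro smooth_add smooth_cmult test_fn_smooth)
  ultimately show ?thesis unfolding test_fn_iff by blast
qed

lemma test_fn_deriv: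
  assumes "test_fn f" shows "test_fn (deriv f)"
proof -
  obtain R where R: "R > 0" "\<And>x. R \<le> \<bar>x\<bar> \<Longrightarrow> f x = 0"
    using test_fn_support[OF assms] by metis
  have "deriv f x = 0" if "R < \<bar>x\<bar>" for x
  proof -
    have "((\<lambda>x. 0) has_real_derivative 0) (at x)" by simp
    then have "(f has_real_derivative 0) (at x)"
      by (rule has_field_derivative_transform_within_open[where S = "{..<-R} \<union> {R<..}"])
        (use R that in auto)
    then show ?thesis by (rule DERIV_imp_deriv)
  qed
  then show ?thesis using assms by (auto simp: test_fn_iff intro: smooth_deriv)
qed

lemma test_fn_funpow_deriv: "test_fn f \<Longrightarrow> test_fn ((deriv ^^ k) f)"
  by (induction k) (auto intro: test_fn_deriv)

lemma deriv_lincomb_smooth: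
  "smooth f \<Longrightarrow> smooth g \<Longrightarrow> deriv (\<lambda>x. f x + c * g x) = (\<lambda>x. deriv f x + c * deriv g x)"
  by (simp add: deriv_add_smooth deriv_cmult_smooth smooth_cmult)

lemma funpow_deriv_lincomb:
  assumes "smooth f" "smooth g"
  shows "(deriv ^^ k) (\<lambda>x. f x + c * g x) = (\<lambda>x. (deriv ^^ k) f x + c * (deriv ^^ k) g x)"
  by (induction k) (simp_all add: deriv_lincomb_smooth smooth_funpow_deriv assms)

lemma test_fn_bump:
  fixes a b :: real
  obtains \<phi> where "test_fn \<phi>" "\<And>x. \<phi> x \<ge> 0" "\<And>x. \<phi> x > 0 \<longleftrightarrow> a < x \<and> x < b"
proof
  let ?\<phi> = "\<lambda>x. flat 1 (1 * x + (- a)) * flat 1 ((-1) * x + b)"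
  show "test_fn ?\<phi>"
    unfolding test_fn_iff
  proof
    show "smooth ?\<phi>" by (intro smooth_mult smooth_affine smooth_flat)
    have "?\<phi> x = 0" if "\<bar>a\<bar> + \<bar>b\<bar> < \<bar>x\<bar>" for x
      using that by (auto simp: flat_def)
    then show "\<exists>R. \<forall>x. R < \<bar>x\<bar> \<longrightarrow> ?\<phi> x = 0" by blast
  qed
qed (auto simp: flat_def)

section \<open>Distributional equations with constant coefficients\<close>

text \<open>Borel and locally bounded: the functions that can be paired with test functions.\<close>
definition ldom :: "(real \<Rightarrow> real) \<Rightarrow> bool" where
  "ldom f \<longleftrightarrow> f \<in> borel_measurable borel
     \<and> (\<exists>g. continuous_on UNIV g \<and> (\<forall>x. \<bar>f x\<bar> \<le> g x))"

lemma continuous_imp_ldom: "continuous_on UNIV f \<Longrightarrow> ldom f"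
  unfolding ldom_def
  by (auto intro!: borel_measurable_continuous_onI exI[of _ "\<lambda>x. \<bar>f x\<bar>"] continuous_intros)

lemma ldom_lincomb:
  assumes "ldom f" "ldom g" shows "ldom (\<lambda>x. f x + c * g x)"
proof -
  obtain F G where FG: "continuous_on UNIV F" "continuous_on UNIV G"
    "\<And>x. \<bar>f x\<bar> \<le> F x" "\<And>x. \<bar>g x\<bar> \<le> G x" using assms unfolding ldom_def by metis
  have "\<bar>f x + c * g x\<bar> \<le> F x + \<bar>c\<bar> * G x" for x
    by (rule order_trans[OF abs_triangle_ineq]) (auto simp: abs_mult intro!: add_mono mult_left_mono FG)
  moreover have "continuous_on UNIV (\<lambda>x. F x + \<bar>c\<bar> * G x)" by (intro continuous_intros FG)
  ultimately show ?thesis using assms unfolding ldom_def by (auto intro!: exI[of _ "\<lambda>x. F x + \<bar>c\<bar> * G x"])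
qed

lemma continuous_supp_integrable:
  fixes f :: "real \<Rightarrow> real"
  assumes "continuous_on UNIV f" and "\<And>x. R \<le> \<bar>x\<bar> \<Longrightarrow> f x = 0"
  shows "integrable lborel f"
proof -
  have "integrable lborel (\<lambda>x. indicator {-R..R} x *\<^sub>R f x)"
    by (intro borel_integrable_compact continuous_on_subset[OF assms(1)]) auto
  also have "(\<lambda>x. indicator {-R..R} x *\<^sub>R f x) = f"
  proof
    show "indicator {-R..R} x *\<^sub>R f x = f x" for x
      using assms(2)[of x] by (cases "x \<in> {-R..R}") auto
  qed
  finally show ?thesis .
qed

lemma pairing_integrable:
  assumes "ldom f" "test_fn \<phi>" shows "integrable lborel (\<lambda>x. f x * \<phi> x)"
proof -
  obtain F where F: "continuous_on UNIV F" "\<And>x. \<bar>f x\<bar> \<le> F x" and m: "f \<in> borel_measurable borel"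
    using assms unfolding ldom_def by metis
  obtain R where R: "\<And>x. R \<le> \<bar>x\<bar> \<Longrightarrow> \<phi> x = 0" using test_fn_support[OF assms(2)] by metis
  have cont: "continuous_on UNIV \<phi>" using assms(2) test_fn_smooth smooth_imp_continuous_on by blast
  have "integrable lborel (\<lambda>x. F x * \<bar>\<phi> x\<bar>)"
    by (rule continuous_supp_integrable[where R = R]) (auto intro!: continuous_intros F cont simp: R)
  then show ?thesis
  proof (rule Bochner_Integration.integrable_bound)
    show "(\<lambda>x. f x * \<phi> x) \<in> borel_measurable lborel"
      using m borel_measurable_continuous_onI[OF cont] by simp
    show "AE x in lborel. norm (f x * \<phi> x) \<le> norm (F x * \<bar>\<phi> x\<bar>)"
      using F(2) by (auto simp: abs_mult intro!: mult_right_mono AE_I2) (meson abs_ge_self order_trans)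
  qed
qed

lemma has_integral_imp_LINT:
  fixes f :: "real \<Rightarrow> real"
  assumes "integrable lborel f" "(f has_integral I) {-R..R}" "\<And>x. R \<le> \<bar>x\<bar> \<Longrightarrow> f x = 0"
  shows "integral\<^sup>L lborel f = I"
proof -
  have "(f has_integral I) UNIV"
    by (rule has_integral_on_superset[OF assms(2)]) (use assms(3) in auto)
  then show ?thesis
    using has_integral_integral_lborel[OF assms(1)] has_integral_unique by blast
qed

text \<open>Finitely many corners of \<open>f\<close> are harmless for the fundamental theorem of
  calculus, while a jump would add a point mass; this is why \<open>f\<close> is continuous across
  \<open>X\<close>.\<close>

lemma pairing_by_parts:
  assumes \<phi>: "test_fn \<phi>" and f: "continuous_on UNIV f" and X: "finite X"
    and D: "\<And>x. x \<notin> X \<Longrightarrow> (f has_real_derivative f' x) (at x)" and f': "ldom f'"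
  shows "(LINT x|lborel. f x * deriv \<phi> x) = - (LINT x|lborel. f' x * \<phi> x)"
proof -
  obtain R where R: "\<And>x. R \<le> \<bar>x\<bar> \<Longrightarrow> \<phi> x = 0" "R > 0" using test_fn_support[OF \<phi>] by metis
  obtain R' where R': "\<And>x. R' \<le> \<bar>x\<bar> \<Longrightarrow> deriv \<phi> x = 0" "R' > R"
    using test_fn_support[OF test_fn_deriv[OF \<phi>]] by metis
  have s: "smooth \<phi>" using \<phi> test_fn_smooth by blast
  have i1: "integrable lborel (\<lambda>x. f x * deriv \<phi> x)"
    by (intro pairing_integrable continuous_imp_ldom f test_fn_deriv \<phi>)
  have i2: "integrable lborel (\<lambda>x. f' x * \<phi> x)"
    by (intro pairing_integrable f' \<phi>)
  have "((\<lambda>x. f x * deriv \<phi> x + f' x * \<phi> x) has_integral (f R' * \<phi> R' - f (-R') * \<phi> (-R'))) {-R'..R'}"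
  proof (rule fundamental_theorem_of_calculus_interior_strong[OF X])
    show "continuous_on {-R'..R'} (\<lambda>x. f x * \<phi> x)"
      by (intro continuous_intros continuous_on_subset[OF f] smooth_imp_continuous_on s) auto
    show "((\<lambda>x. f x * \<phi> x) has_vector_derivative f x * deriv \<phi> x + f' x * \<phi> x) (at x)"
      if "x \<in> {-R'<..<R'} - X" for x
      unfolding has_real_derivative_iff_has_vector_derivative[symmetric]
      using that by (auto intro!: derivative_eq_intros D smooth_imp_DERIV[OF s])
  qed (use R R' in auto)
  then have "(LINT x|lborel. f x * deriv \<phi> x + f' x * \<phi> x) = f R' * \<phi> R' - f (-R') * \<phi> (-R')"
    by (intro has_integral_imp_LINT[where R = R']) (use i1 i2 R R' in auto)
  also have "\<dots> = 0" using R R' by simp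
  finally show ?thesis using i1 i2 by simp
qed

text \<open>Continuity is asked only for indices below \<open>k\<close>, so the last function may
  jump. This lets the ladder \<open>sgn_tail\<close> descend to its discontinuous entry at index
  0.\<close>

lemma pairing_by_parts_iterate:
  assumes \<phi>: "test_fn \<phi>" and X: "finite X"
    and fs: "\<And>i. i < k \<Longrightarrow> continuous_on UNIV (fs i)"
    and D: "\<And>i x. i < k \<Longrightarrow> x \<notin> X \<Longrightarrow> (fs i has_real_derivative fs (Suc i) x) (at x)"
    and dom: "\<And>i. i \<le> k \<Longrightarrow> ldom (fs i)"
  shows "(LINT x|lborel. fs 0 x * (deriv ^^ k) \<phi> x) = (-1) ^ k * (LINT x|lborel. fs k x * \<phi> x)"
  using fs D dom
proof (induction k arbitrary: fs)
  case (Suc k)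
  have "(LINT x|lborel. fs 0 x * (deriv ^^ Suc k) \<phi> x) = - (LINT x|lborel. fs 1 x * (deriv ^^ k) \<phi> x)"
    using pairing_by_parts[OF test_fn_funpow_deriv[OF \<phi>], of "fs 0" X "fs 1"] Suc.prems(1)[of 0] X Suc.prems(2)[of 0] Suc.prems(3)[of 1]
    by simp
  also have "(LINT x|lborel. fs 1 x * (deriv ^^ k) \<phi> x) = (-1) ^ k * (LINT x|lborel. fs (Suc k) x * \<phi> x)"
    using Suc.IH[of "\<lambda>i. fs (Suc i)"] Suc.prems by simp
  finally show ?case by simp
qed simp

section \<open>Functionals annihilating D - c, and du Bois-Reymond lemmas\<close>

lemma test_fn_antiderivative:
  assumes \<phi>: "test_fn \<phi>" and I: "(LINT x|lborel. exp (- (c * x)) * \<phi> x) = 0"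
  obtains \<eta> where "test_fn \<eta>" "\<And>x. deriv \<eta> x = c * \<eta> x + \<phi> x"
proof -
  \<comment> \<open>Variation of constants: e^(cx) times a primitive of f solves the equation. The
    hypothesis on the integral says exactly that this primitive vanishes again to the right of the
    support.\<close>
  define f where "f = (\<lambda>x. exp (- (c * x)) * \<phi> x)"
  obtain R where R: "\<And>x. R \<le> \<bar>x\<bar> \<Longrightarrow> \<phi> x = 0" "R > 0" using test_fn_support[OF \<phi>] by metis
  have s: "smooth \<phi>" using \<phi> test_fn_smooth by blast
  have f0: "f x = 0" if "R \<le> \<bar>x\<bar>" for x using R(1)[OF that] by (simp add: f_def)
  have cf: "continuous_on A f" for A
    unfolding f_def by (intro continuous_intros smooth_imp_continuous_on s)
  have int: "integrable lborel f" by (rule continuous_supp_integrable[OF cf f0])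
  \<comment> \<open>Starting at -R - 1 instead of -R leaves every point x with x \<ge> -R in the
    interior of the interval of integration, where the derivative is two-sided.\<close>
  define F where "F = (\<lambda>x. integral {-R-1..x} f)"
  have F_left: "F x = 0" if "x \<le> - R" for x
    unfolding F_def by (rule integral_unique, rule has_integral_is_0) (use that f0 in auto)
  have F_right: "F x = 0" if "R \<le> x" for x
  proof -
    have "(f has_integral integral\<^sup>L lborel f) UNIV" by (rule has_integral_integral_lborel[OF int])
    moreover have "(f has_integral F x) UNIV"
      unfolding F_def
      by (rule has_integral_on_superset[OF integrable_integral])
        (use that f0 in \<open>auto intro!: integrable_continuous_real cf\<close>)
    ultimately show ?thesis using I has_integral_unique unfolding f_def by metis
  qed
  have DF: "(F has_real_derivative f x) (at x)" for x
  proof (cases "x < - R")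
    case True
    have "((\<lambda>x. 0) has_real_derivative f x) (at x)" using True R(2) f0[of x] by auto
    then show ?thesis
      by (rule has_field_derivative_transform_within_open[where S = "{..<-R}"])
        (use True F_left in auto)
  next
    case False
    have "((\<lambda>x. integral {-R-1..x} f) has_real_derivative f x) (at x within {-R-1..x+1})"
      by (rule integral_has_real_derivative[OF cf]) (use False in auto)
    moreover have "at x within {-R-1..x+1} = at x"
      by (rule at_within_interior) (use False in auto)
    ultimately show ?thesis by (simp add: F_def)
  qed
  define \<eta> where "\<eta> = (\<lambda>x. exp (c * x) * F x)"
  have D\<eta>: "(\<eta> has_real_derivative c * \<eta> x + \<phi> x) (at x)" for x
    unfolding \<eta>_def
    by (auto intro!: derivative_eq_intros DF simp: f_def exp_minus algebra_simps)
  have "smooth \<eta>" by (rule smooth_ode[OF D\<eta> s])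
  moreover have "\<forall>x. R < \<bar>x\<bar> \<longrightarrow> \<eta> x = 0"
    using F_left F_right by (force simp: \<eta>_def abs_if split: if_splits)
  ultimately have "test_fn \<eta>" unfolding test_fn_iff by blast
  then show ?thesis using that D\<eta> DERIV_imp_deriv by blast
qed

text \<open>The image of D - c is the kernel of the functional \<open>?I\<close>, by
  \<open>test_fn_antiderivative\<close>. A functional vanishing on that image is therefore a
  multiple of \<open>?I\<close>, and one bump with nonzero \<open>?I\<close> determines the
  factor.\<close>

lemma test_functional_kernel:
  fixes F :: "(real \<Rightarrow> real) \<Rightarrow> real"
  assumes lin: "\<And>f g a. test_fn f \<Longrightarrow> test_fn g \<Longrightarrow> F (\<lambda>x. f x + a * g x) = F f + a * F g"
    and ker: "\<And>f. test_fn f \<Longrightarrow> F (\<lambda>x. deriv f x + (- c) * f x) = 0"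
  obtains a where "\<And>\<phi>. test_fn \<phi> \<Longrightarrow> F \<phi> = a * (LINT x|lborel. exp (- (c * x)) * \<phi> x)"
proof -
  let ?I = "\<lambda>\<phi>. LINT x|lborel. exp (- (c * x)) * \<phi> x"
  have ld: "ldom (\<lambda>x. exp (- (c * x)))" by (intro continuous_imp_ldom continuous_intros)
  have Ilin: "?I (\<lambda>x. f x + a * g x) = ?I f + a * ?I g" if "test_fn f" "test_fn g" for f g a
  proof -
    have "?I (\<lambda>x. f x + a * g x) = (LINT x|lborel. exp (- (c * x)) * f x + a * (exp (- (c * x)) * g x))"
      by (simp add: algebra_simps)
    then show ?thesis using pairing_integrable[OF ld that(1)] pairing_integrable[OF ld that(2)] by simp
  qed
  obtain \<rho> where \<rho>: "test_fn \<rho>" "\<And>x. \<rho> x \<ge> 0" "\<And>x. \<rho> x > 0 \<longleftrightarrow> (0::real) < x \<and> x < 1"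
    using test_fn_bump[of 0 1] by metis
  have "?I \<rho> \<noteq> 0"
  proof
    assume I0: "?I \<rho> = 0"
    have "((\<lambda>x. exp (- (c * x)) * \<rho> x) has_integral ?I \<rho>) UNIV"
      by (rule has_integral_integral_lborel[OF pairing_integrable[OF ld \<rho>(1)]])
    moreover have "(\<lambda>x. if x \<in> {0..1} then exp (- (c * x)) * \<rho> x else 0) = (\<lambda>x. exp (- (c * x)) * \<rho> x)"
      using \<rho>(2,3) by (fastforce simp: fun_eq_iff not_le order.order_iff_strict)
    ultimately have "((\<lambda>x. exp (- (c * x)) * \<rho> x) has_integral 0) (cbox 0 1)"
      using I0 has_integral_restrict_UNIV[of "{0..1}" "\<lambda>x. exp (- (c * x)) * \<rho> x"] by simp
    then have "exp (- (c * (1/2))) * \<rho> (1/2) = 0"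
      by (rule has_integral_0_cbox_imp_0[rotated 2])
        (use \<rho>(2) in \<open>auto intro!: continuous_intros smooth_imp_continuous_on[OF test_fn_smooth[OF \<rho>(1)]]\<close>)
    then show False using \<rho>(3)[of "1/2"] by simp
  qed
  show ?thesis
  proof (rule that[of "F \<rho> / ?I \<rho>"])
    fix \<phi> assume \<phi>: "test_fn \<phi>"
    define a where "a = ?I \<phi> / ?I \<rho>"
    have t: "test_fn (\<lambda>x. \<phi> x + (- a) * \<rho> x)" by (intro test_fn_lincomb \<phi> \<rho>)
    have "?I (\<lambda>x. \<phi> x + (- a) * \<rho> x) = 0"
      unfolding Ilin[OF \<phi> \<rho>(1)] a_def using \<open>?I \<rho> \<noteq> 0\<close> by simp
    then obtain \<eta> where \<eta>: "test_fn \<eta>" "\<And>x. deriv \<eta> x = c * \<eta> x + (\<phi> x + (- a) * \<rho> x)"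
      using test_fn_antiderivative[OF t] by metis
    have "F (\<lambda>x. \<phi> x + (- a) * \<rho> x) = F (\<lambda>x. deriv \<eta> x + (- c) * \<eta> x)"
      by (simp add: \<eta>(2))
    also have "\<dots> = 0" by (rule ker[OF \<eta>(1)])
    finally show "F \<phi> = F \<rho> / ?I \<rho> * ?I \<phi>"
      unfolding lin[OF \<phi> \<rho>(1)] a_def using \<open>?I \<rho> \<noteq> 0\<close> by (simp add: field_simps)
  qed
qed

lemma pairing_lincomb_left:
  assumes "ldom f" "ldom g" "test_fn \<phi>"
  shows "(LINT x|lborel. (f x + c * g x) * \<phi> x) = (LINT x|lborel. f x * \<phi> x) + c * (LINT x|lborel. g x * \<phi> x)"
proof -
  have "(LINT x|lborel. (f x + c * g x) * \<phi> x) = (LINT x|lborel. f x * \<phi> x + c * (g x * \<phi> x))"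
    by (simp add: algebra_simps)
  then show ?thesis using pairing_integrable[OF assms(1,3)] pairing_integrable[OF assms(2,3)] by simp
qed

lemma pairing_lincomb_right:
  assumes "ldom u" "test_fn f" "test_fn g"
  shows "(LINT x|lborel. u x * (f x + c * g x)) = (LINT x|lborel. u x * f x) + c * (LINT x|lborel. u x * g x)"
proof -
  have "(LINT x|lborel. u x * (f x + c * g x)) = (LINT x|lborel. u x * f x + c * (u x * g x))"
    by (simp add: algebra_simps)
  then show ?thesis using pairing_integrable[OF assms(1,2)] pairing_integrable[OF assms(1,3)] by simp
qed

lemma pairing_zero_imp_zero:
  assumes u: "continuous_on UNIV u" and z: "\<And>\<phi>. test_fn \<phi> \<Longrightarrow> (LINT x|lborel. u x * \<phi> x) = 0"
  shows "u x = 0"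
proof (rule ccontr)
  assume nz: "u x \<noteq> 0"
  have "\<forall>\<^sub>F y in at x. \<bar>u y - u x\<bar> < \<bar>u x\<bar>"
    using u nz by (auto simp: continuous_on_eq_continuous_at isCont_def tendsto_iff dist_real_def)
  then obtain d where d: "d > 0" "\<And>y. y \<noteq> x \<Longrightarrow> \<bar>y - x\<bar> < d \<Longrightarrow> \<bar>u y - u x\<bar> < \<bar>u x\<bar>"
    by (auto simp: eventually_at dist_real_def)
  have pos: "u x * u y > 0" if "\<bar>y - x\<bar> < d" for y
  proof -
    have "\<bar>u y - u x\<bar> < \<bar>u x\<bar>" using d(2)[of y] that nz by (cases "y = x") auto
    then have "u x > 0 \<and> u y > 0 \<or> u x < 0 \<and> u y < 0" by linarith
    then show ?thesis by (auto simp: zero_less_mult_iff)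
  qed
  obtain \<rho> where \<rho>: "test_fn \<rho>" "\<And>y. \<rho> y \<ge> 0" "\<And>y. \<rho> y > 0 \<longleftrightarrow> x - d < y \<and> y < x + d"
    using test_fn_bump[of "x - d" "x + d"] by metis
  have \<rho>0: "\<rho> y = 0" if "\<not> (x - d < y \<and> y < x + d)" for y
    using \<rho>(2,3)[of y] that by linarith
  have "((\<lambda>y. u y * \<rho> y) has_integral 0) UNIV"
    using has_integral_integral_lborel[OF pairing_integrable[OF continuous_imp_ldom[OF u] \<rho>(1)]] z[OF \<rho>(1)]
    by simp
  \<comment> \<open>The constant factor \<open>u x\<close> makes the integrand nonnegative whatever
    the sign of \<open>u x\<close>, so a vanishing integral forces it to vanish at x.\<close>
  then have "((\<lambda>y. u x * (u y * \<rho> y)) has_integral u x * 0) UNIV"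
    by (rule has_integral_mult_right)
  moreover have "(\<lambda>y. if y \<in> {x-d..x+d} then u x * (u y * \<rho> y) else 0) = (\<lambda>y. u x * (u y * \<rho> y))"
    using \<rho>0 by (auto simp: fun_eq_iff)
  ultimately have "((\<lambda>y. u x * (u y * \<rho> y)) has_integral 0) (cbox (x-d) (x+d))"
    using has_integral_restrict_UNIV[of "{x-d..x+d}" "\<lambda>y. u x * (u y * \<rho> y)"] by simp
  then have "u x * (u x * \<rho> x) = 0"
  proof (rule has_integral_0_cbox_imp_0[rotated 2])
    show "continuous_on (cbox (x - d) (x + d)) (\<lambda>y. u x * (u y * \<rho> y))"
      by (intro continuous_intros continuous_on_subset[OF u] smooth_imp_continuous_on test_fn_smooth \<rho>) auto
    show "0 \<le> u x * (u y * \<rho> y)" if "y \<in> box (x-d) (x+d)" for y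
    proof -
      have "\<bar>y - x\<bar> < d" using that by auto
      then have "0 \<le> u x * u y * \<rho> y" using pos[of y] \<rho>(2)[of y] by simp
      then show ?thesis by (simp add: mult.assoc)
    qed
  qed (use d in auto)
  then show False using nz \<rho>(3)[of x] d by simp
qed

lemma poly_pairing_deriv:
  assumes "test_fn \<phi>"
  shows "(LINT x|lborel. poly p x * (deriv ^^ k) \<phi> x) = (-1) ^ k * (LINT x|lborel. poly ((pderiv ^^ k) p) x * \<phi> x)"
  using pairing_by_parts_iterate[OF assms finite.emptyI, of k "\<lambda>i. poly ((pderiv ^^ i) p)"]
  by (simp add: poly_DERIV continuous_imp_ldom continuous_on_poly)

lemma exp_pairing_deriv:
  assumes "test_fn \<phi>"
  shows "(LINT x|lborel. exp (c * x) * (deriv ^^ k) \<phi> x) = (-c) ^ k * (LINT x|lborel. exp (c * x) * \<phi> x)"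
proof -
  have "(LINT x|lborel. exp (c * x) * (deriv ^^ k) \<phi> x) = (-1) ^ k * (LINT x|lborel. (c ^ k * exp (c * x)) * \<phi> x)"
    using pairing_by_parts_iterate[OF assms finite.emptyI, of k "\<lambda>i x. c ^ i * exp (c * x)"]
    by (force intro!: derivative_eq_intros continuous_imp_ldom continuous_intros)
  then show ?thesis by (simp add: mult.assoc power_minus[of c])
qed

lemma pderiv_funpow_monom: "(pderiv ^^ k) (monom c k) = [:fact k * c:]" for c :: real
  by (induction k arbitrary: c)
    (simp_all add: monom_0 funpow_Suc_right pderiv_monom algebra_simps del: funpow.simps)

text \<open>Pairing u with the n-th derivative of a test function kills derivatives, hence is a
  multiple of the plain integral. A monomial of degree n has the same pairing; subtracting it lowers
  the order by one.\<close>

lemma deriv_power_annihilated_imp_poly: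
  assumes u: "continuous_on UNIV u"
    and z: "\<And>\<phi>. test_fn \<phi> \<Longrightarrow> (LINT x|lborel. u x * (deriv ^^ n) \<phi> x) = 0"
  shows "\<exists>p. (\<forall>x. u x = poly p x) \<and> (p = 0 \<or> degree p < n)"
  using u z
proof (induction n arbitrary: u)
  case 0
  then have "u x = 0" for x using pairing_zero_imp_zero[OF "0.prems"(1)] by simp
  then show ?case by (intro exI[of _ 0]) auto
next
  case (Suc n)
  have ld: "ldom u" by (rule continuous_imp_ldom[OF Suc.prems(1)])
  define F where "F = (\<lambda>\<phi>. LINT x|lborel. u x * (deriv ^^ n) \<phi> x)"
  obtain a where a: "\<And>\<phi>. test_fn \<phi> \<Longrightarrow> F \<phi> = a * (LINT x|lborel. exp (- (0 * x)) * \<phi> x)"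
  proof (rule test_functional_kernel[of F 0])
    show "F (\<lambda>x. f x + a * g x) = F f + a * F g" if "test_fn f" "test_fn g" for f g a
      using that unfolding F_def
      by (simp add: funpow_deriv_lincomb test_fn_smooth pairing_lincomb_right ld test_fn_funpow_deriv)
    show "F (\<lambda>x. deriv f x + (- 0) * f x) = 0" if "test_fn f" for f
      using Suc.prems(2)[OF that] unfolding F_def by (simp add: funpow_Suc_right del: funpow.simps)
  qed blast
  \<comment> \<open>Moving n derivatives onto the monomial yields the factors (-1)^n and n!; the
    coefficient compensates both.\<close>
  let ?q = "monom ((-1) ^ n * a / fact n) n"
  have "\<exists>p. (\<forall>x. u x + (-1) * poly ?q x = poly p x) \<and> (p = 0 \<or> degree p < n)"
  proof (rule Suc.IH)
    show "continuous_on UNIV (\<lambda>x. u x + (-1) * poly ?q x)"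
      by (intro continuous_intros Suc.prems)
    show "(LINT x|lborel. (u x + (-1) * poly ?q x) * (deriv ^^ n) \<phi> x) = 0" if t: "test_fn \<phi>" for \<phi>
    proof -
      have "(LINT x|lborel. (u x + (-1) * poly ?q x) * (deriv ^^ n) \<phi> x)
        = F \<phi> - (-1) ^ n * (LINT x|lborel. ((-1) ^ n * a) * \<phi> x)"
        using poly_pairing_deriv[OF t, of ?q n]
        by (subst pairing_lincomb_left)
          (simp_all add: ld t test_fn_funpow_deriv continuous_imp_ldom continuous_on_poly F_def pderiv_funpow_monom)
      also have "\<dots> = 0" using a[OF t] by (simp add: power_mult_distrib[symmetric] mult.assoc[symmetric])
      finally show ?thesis .
    qed
  qed
  then obtain p where p: "\<And>x. u x + (-1) * poly ?q x = poly p x" "p = 0 \<or> degree p < n" by blast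
  have "u x = poly (p + ?q) x" for x using p(1)[of x] by simp
  moreover have "degree (p + ?q) \<le> n" using p(2) by (auto intro!: degree_add_le degree_monom_le)
  ultimately show ?case by (intro exI[of _ "p + ?q"]) (auto simp: less_Suc_eq_le)
qed

text \<open>Write \<open>F \<phi>\<close> for the pairing of \<open>u\<close> with the derivative of order \<open>n\<close> of \<open>\<phi>\<close>. Since \<open>F\<close> kills
  the image of \<open>(D - 1)(D + 1)\<close>, both \<open>F \<circ> (D + 1)\<close> and \<open>F \<circ> (D - 1)\<close> are pairings with a multiple of
  an exponential, and \<open>2 F\<close> is their difference.\<close>
lemma homogeneous_solution:
  assumes u: "continuous_on UNIV u" and n: "even n"
    and z: "\<And>\<phi>. test_fn \<phi> \<Longrightarrow>
      (LINT x|lborel. u x * ((deriv ^^ (n + 2)) \<phi> x - (deriv ^^ n) \<phi> x)) = 0"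
  shows "\<exists>p a b. (\<forall>x. u x = poly p x + a * exp x + b * exp (- x)) \<and> (p = 0 \<or> degree p < n)"
proof -
  have ld: "ldom u" by (rule continuous_imp_ldom[OF u])
  define F where "F = (\<lambda>\<phi>. LINT x|lborel. u x * (deriv ^^ n) \<phi> x)"
  have Flin: "F (\<lambda>x. f x + a * g x) = F f + a * F g" if "test_fn f" "test_fn g" for f g a
    using that unfolding F_def
    by (simp add: funpow_deriv_lincomb test_fn_smooth pairing_lincomb_right ld test_fn_funpow_deriv)
  have Fz: "F (\<lambda>x. deriv (deriv f) x + (-1) * f x) = 0" if t: "test_fn f" for f
  proof -
    have "(deriv ^^ n) (\<lambda>x. deriv (deriv f) x + (-1) * f x) = (\<lambda>x. (deriv ^^ (n + 2)) f x - (deriv ^^ n) f x)"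
      using funpow_deriv_lincomb[of "deriv (deriv f)" f n "-1"] t
      by (simp add: test_fn_smooth smooth_deriv funpow_Suc_right del: funpow.simps)
    then show ?thesis using z[OF t] by (simp add: F_def)
  qed
  have ker: "\<exists>a. \<forall>\<phi>. test_fn \<phi> \<longrightarrow> F (\<lambda>x. deriv \<phi> x + c * \<phi> x) = a * (LINT x|lborel. exp (- (c * x)) * \<phi> x)"
    if c: "c * c = 1" for c
  proof -
    define H where "H = (\<lambda>\<phi>. F (\<lambda>x. deriv \<phi> x + c * \<phi> x))"
    have t': "test_fn (\<lambda>x. deriv f x + c * f x)" if "test_fn f" for f
      by (intro test_fn_lincomb test_fn_deriv that)
    have "H (\<lambda>x. f x + a * g x) = H f + a * H g" if t: "test_fn f" "test_fn g" for f g a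
      unfolding H_def Flin[OF t'[OF t(1)] t'[OF t(2)], symmetric] deriv_lincomb_smooth[OF t[THEN test_fn_smooth]]
      by (simp add: algebra_simps)
    moreover have "H (\<lambda>x. deriv f x + (- c) * f x) = 0" if t: "test_fn f" for f
    proof -
      have E: "(\<lambda>x. deriv (deriv f) x + - c * deriv f x + c * (deriv f x + - c * f x))
          = (\<lambda>x. deriv (deriv f) x + (-1) * f x)"
      proof
        fix x
        have "deriv (deriv f) x + - c * deriv f x + c * (deriv f x + - c * f x) = deriv (deriv f) x - (c * c) * f x"
          by algebra
        then show "deriv (deriv f) x + - c * deriv f x + c * (deriv f x + - c * f x) = deriv (deriv f) x + (-1) * f x"
          using c by simp
      qed
      show ?thesis
        unfolding H_def deriv_lincomb_smooth[OF smooth_deriv[OF test_fn_smooth[OF t]] test_fn_smooth[OF t]]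
        unfolding E by (rule Fz[OF t])
    qed
    ultimately obtain a where "\<And>\<phi>. test_fn \<phi> \<Longrightarrow> H \<phi> = a * (LINT x|lborel. exp (- (c * x)) * \<phi> x)"
      using test_functional_kernel[of H c] by blast
    then show ?thesis unfolding H_def by blast
  qed
  obtain a where a: "\<And>\<phi>. test_fn \<phi> \<Longrightarrow> F (\<lambda>x. deriv \<phi> x + 1 * \<phi> x) = a * (LINT x|lborel. exp (- (1 * x)) * \<phi> x)"
    using ker[of 1] by auto
  obtain b where b: "\<And>\<phi>. test_fn \<phi> \<Longrightarrow> F (\<lambda>x. deriv \<phi> x + (-1) * \<phi> x) = b * (LINT x|lborel. exp (- ((-1) * x)) * \<phi> x)"
    using ker[of "-1"] by auto
  have F: "F \<phi> = (a/2) * (LINT x|lborel. exp ((-1) * x) * \<phi> x) + (- b/2) * (LINT x|lborel. exp (1 * x) * \<phi> x)"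
    if t: "test_fn \<phi>" for \<phi>
  proof -
    have "F (\<lambda>x. deriv \<phi> x + 1 * \<phi> x) = F (deriv \<phi>) + 1 * F \<phi>" "F (\<lambda>x. deriv \<phi> x + (-1) * \<phi> x) = F (deriv \<phi>) + (-1) * F \<phi>"
      by (rule Flin[OF test_fn_deriv[OF t] t])+
    then show ?thesis using a[OF t] b[OF t] by simp
  qed
  \<comment> \<open>Moving n derivatives onto e^x or e^(-x) gives the factor (-1)^n or 1, and both
    are 1 because n is even. Removing the two exponentials found in \<open>F\<close> therefore
    leaves a function that pairs to zero with all n-th derivatives.\<close>
  define v where "v = (\<lambda>x. (u x + (- a/2) * exp ((-1) * x)) + (b/2) * exp (1 * x))"
  have "\<exists>p. (\<forall>x. v x = poly p x) \<and> (p = 0 \<or> degree p < n)"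
  proof (rule deriv_power_annihilated_imp_poly)
    show "continuous_on UNIV v" unfolding v_def by (intro continuous_intros u)
    fix \<phi> assume t: "test_fn \<phi>"
    have le: "ldom (\<lambda>x. exp (c * x))" for c :: real by (intro continuous_imp_ldom continuous_intros)
    have "(LINT x|lborel. v x * (deriv ^^ n) \<phi> x)
      = F \<phi> + (- a/2) * (LINT x|lborel. exp ((-1) * x) * (deriv ^^ n) \<phi> x) + (b/2) * (LINT x|lborel. exp (1 * x) * (deriv ^^ n) \<phi> x)"
      unfolding v_def F_def
        pairing_lincomb_left[OF ldom_lincomb[OF ld le] le test_fn_funpow_deriv[OF t]]
        pairing_lincomb_left[OF ld le test_fn_funpow_deriv[OF t]] ..
    also have "\<dots> = 0"
      unfolding exp_pairing_deriv[OF t] F[OF t] using n by simp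
    finally show "(LINT x|lborel. v x * (deriv ^^ n) \<phi> x) = 0" .
  qed
  then obtain p where p: "\<And>x. v x = poly p x" "p = 0 \<or> degree p < n" by blast
  have "u x = poly p x + (- b/2) * exp x + (a/2) * exp (- x)" for x
    using p(1)[of x] unfolding v_def by simp
  then show ?thesis using p(2) by blast
qed

section \<open>The fundamental solution\<close>

text \<open>\<open>htail n x\<close> is the Taylor tail \<open>\<Sum>i. x\<^sup>n\<^sup>+\<^sup>2\<^sup>i / (n + 2 i)!\<close> of \<open>cosh\<close> or \<open>sinh\<close>.\<close>
fun htail :: "nat \<Rightarrow> real \<Rightarrow> real" where
  "htail 0 x = cosh x"
| "htail (Suc 0) x = sinh x"
| "htail (Suc (Suc n)) x = htail n x - x ^ n / fact n"

lemma htail_DERIV: "(htail (Suc n) has_real_derivative htail n x) (at x)"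
proof (induction n rule: induct_nat_012)
  case 0
  have "htail (Suc 0) = sinh" "htail 0 = cosh" by (simp_all add: fun_eq_iff)
  moreover have "(sinh has_real_derivative cosh x) (at x)" by (auto intro!: derivative_eq_intros)
  ultimately show ?case by simp
next
  case 1
  have "htail (Suc (Suc 0)) = (\<lambda>x. cosh x - 1)" by (simp add: fun_eq_iff)
  then show ?case by (auto intro!: derivative_eq_intros)
next
  case (ge2 n)
  have "htail (Suc (Suc (Suc n))) = (\<lambda>x. htail (Suc n) x - x ^ Suc n / fact (Suc n))"
    by (simp add: fun_eq_iff)
  moreover have "((\<lambda>x::real. x ^ Suc n / fact (Suc n)) has_real_derivative x ^ n / fact n) (at x)"
    using DERIV_cdivide[OF DERIV_pow[of "Suc n" x UNIV], of "fact (Suc n)"]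
    by (simp add: field_simps del: of_nat_Suc)
  ultimately show ?case using DERIV_diff[OF ge2(1)] by simp
qed

lemma htail_continuous: "continuous_on A (htail n)"
proof (cases n)
  case 0
  then have "htail n = cosh" by (simp add: fun_eq_iff)
  then show ?thesis by (auto intro!: continuous_intros)
next
  case (Suc k)
  then show ?thesis using htail_DERIV by (meson DERIV_continuous continuous_at_imp_continuous_on)
qed

lemma htail_Suc_0: "htail (Suc n) 0 = 0"
  by (induction n rule: induct_nat_012) auto

lemma htail_odd:
  "htail (Suc (2 * n)) x = (exp x - exp (- x)) / 2 - (\<Sum>k=1..n. x ^ (2 * k - 1) / fact (2 * k - 1))"
  by (induction n) (simp_all add: sinh_field_def)

text \<open>Index 2m - 1 is \<open>G\<close>, and lower indices are its derivatives away from 0. A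
  positive index gives a continuous function because \<open>htail\<close> vanishes at 0; index 0 has
  a unit jump there, the source of the Dirac mass.\<close>

definition sgn_tail :: "nat \<Rightarrow> real \<Rightarrow> real" where
  "sgn_tail n x = sgn x / 2 * htail n x"

lemma G_eq_sgn_tail: "m \<ge> 1 \<Longrightarrow> G m = sgn_tail (2 * m - 1)"
  using htail_odd[of "m - 1"] by (cases m) (auto simp: G_def sgn_tail_def fun_eq_iff)

lemma sgn_tail_DERIV:
  assumes "x \<noteq> 0" shows "(sgn_tail (Suc n) has_real_derivative sgn_tail n x) (at x)"
proof -
  have "((\<lambda>y. sgn x / 2 * htail (Suc n) y) has_real_derivative sgn_tail n x) (at x)"
    unfolding sgn_tail_def by (intro DERIV_cmult htail_DERIV)
  then show ?thesis
    by (rule has_field_derivative_transform_within_open[where S = "if x > 0 then {0<..} else {..<0}"])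
      (use assms in \<open>auto simp: sgn_tail_def split: if_splits\<close>)
qed

lemma sgn_tail_continuous: "continuous_on A (sgn_tail (Suc n))"
proof -
  have "isCont (sgn_tail (Suc n)) x" for x
  proof (cases "x = 0")
    case True
    have "isCont (htail (Suc n)) 0" using htail_DERIV DERIV_isCont by blast
    then have "((\<lambda>x. \<bar>htail (Suc n) x\<bar>) \<longlongrightarrow> 0) (at 0)"
      using tendsto_rabs_zero_iff htail_Suc_0 by (fastforce simp: isCont_def)
    then have "(sgn_tail (Suc n) \<longlongrightarrow> 0) (at 0)"
      by (rule Lim_null_comparison[rotated]) (auto simp: sgn_tail_def abs_mult sgn_real_def)
    then show ?thesis using True by (simp add: isCont_def sgn_tail_def)
  next
    case False
    then show ?thesis using sgn_tail_DERIV DERIV_isCont by blast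
  qed
  then show ?thesis by (simp add: continuous_at_imp_continuous_on)
qed

lemma sgn_tail_shift_continuous: "continuous_on A (\<lambda>x. sgn_tail (Suc n) (x - a))"
  by (rule continuous_on_compose2[OF sgn_tail_continuous]) (auto intro!: continuous_intros)

lemma sgn_tail_shift_DERIV: "x \<noteq> a \<Longrightarrow> ((\<lambda>x. sgn_tail (Suc n) (x - a)) has_real_derivative sgn_tail n (x - a)) (at x)"
  using DERIV_shift[of "sgn_tail (Suc n)" "sgn_tail n (x - a)" x "- a"] sgn_tail_DERIV[of "x - a" n] by simp

lemma ldom_sgn_tail_comp:
  assumes "continuous_on UNIV h" shows "ldom (\<lambda>x. sgn_tail n (h x))"
  unfolding ldom_def
proof (intro conjI exI allI)
  have "continuous_on UNIV (\<lambda>x. htail n (h x))"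
    by (rule continuous_on_compose2[OF htail_continuous[of UNIV]]) (use assms in auto)
  then show "continuous_on UNIV (\<lambda>x. \<bar>htail n (h x)\<bar>)" by (intro continuous_intros)
  have [measurable]: "(\<lambda>x. htail n (h x)) \<in> borel_measurable borel" "h \<in> borel_measurable borel"
    by (intro borel_measurable_continuous_onI \<open>continuous_on UNIV (\<lambda>x. htail n (h x))\<close> assms)+
  show "(\<lambda>x. sgn_tail n (h x)) \<in> borel_measurable borel" unfolding sgn_tail_def sgn_real_def by measurable
  show "\<bar>sgn_tail n (h x)\<bar> \<le> \<bar>htail n (h x)\<bar>" for x by (auto simp: sgn_tail_def abs_mult sgn_real_def)
qed

lemma ldom_sgn_tail_shift: "ldom (\<lambda>x. sgn_tail n (x - a))"
  by (intro ldom_sgn_tail_comp continuous_intros)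

lemma sgn_tail_pairing_iterate:
  assumes "test_fn \<phi>"
  shows "(LINT x|lborel. sgn_tail (k + j) (x - a) * (deriv ^^ k) \<phi> x) = (-1) ^ k * (LINT x|lborel. sgn_tail j (x - a) * \<phi> x)"
  using pairing_by_parts_iterate[OF assms, of "{a}" k "\<lambda>i x. sgn_tail (k + j - i) (x - a)"]
  by (simp add: ldom_sgn_tail_shift Suc_diff_le sgn_tail_shift_continuous sgn_tail_shift_DERIV
      flip: Suc_diff_Suc add: Suc_diff_Suc[symmetric])

lemma sgn_measurable [measurable]: "(\<lambda>x::real. sgn (x - a)) \<in> borel_measurable borel"
  unfolding sgn_real_def by measurable

lemma ldom_sgn: "ldom (\<lambda>x. sgn (x - a))"
  unfolding ldom_def by (auto intro!: exI[of _ "\<lambda>x. 1"] simp: sgn_real_def sgn_measurable[unfolded sgn_real_def])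

lemma sgn_pairing_deriv:
  assumes t: "test_fn \<phi>"
  shows "(LINT x|lborel. sgn (x - a) * deriv \<phi> x) = - 2 * \<phi> a"
proof -
  obtain R where R: "R > \<bar>a\<bar>" "\<And>x. R \<le> \<bar>x\<bar> \<Longrightarrow> \<phi> x = 0" using test_fn_support[OF t] by metis
  obtain R' where R': "R' > R" "\<And>x. R' \<le> \<bar>x\<bar> \<Longrightarrow> deriv \<phi> x = 0"
    using test_fn_support[OF test_fn_deriv[OF t]] by metis
  have s: "smooth \<phi>" by (rule test_fn_smooth[OF t])
  \<comment> \<open>Subtracting \<open>\<phi> a\<close> makes this primitive continuous at a.
    Outside the support it equals - \<open>\<phi> a\<close> on the right and \<open>\<phi> a\<close>
    on the left, whence the value - 2 \<open>\<phi> a\<close>.\<close>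
  define F where "F = (\<lambda>x. sgn (x - a) * (\<phi> x - \<phi> a))"
  have DF: "(F has_real_derivative sgn (x - a) * deriv \<phi> x) (at x)" if "x \<noteq> a" for x
  proof -
    have "((\<lambda>y. sgn (x - a) * (\<phi> y - \<phi> a)) has_real_derivative sgn (x - a) * deriv \<phi> x) (at x)"
      by (auto intro!: derivative_eq_intros smooth_imp_DERIV s)
    then show ?thesis
      by (rule has_field_derivative_transform_within_open[where S = "if x > a then {a<..} else {..<a}"])
        (use that in \<open>auto simp: F_def split: if_splits\<close>)
  qed
  have "isCont F x" for x
  proof (cases "x = a")
    case True
    have "isCont \<phi> a" using smooth_imp_DERIV[OF s] DERIV_isCont by blast
    then have "((\<lambda>x. \<bar>\<phi> x - \<phi> a\<bar>) \<longlongrightarrow> 0) (at a)"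
      by (simp add: isCont_def LIM_zero_iff tendsto_rabs_zero_iff)
    then have "(F \<longlongrightarrow> 0) (at a)"
      by (rule Lim_null_comparison[rotated]) (auto simp: F_def abs_mult sgn_real_def)
    then show ?thesis using True by (simp add: isCont_def F_def)
  qed (use DF DERIV_isCont in blast)
  then have "((\<lambda>x. sgn (x - a) * deriv \<phi> x) has_integral F R' - F (- R')) {-R'..R'}"
    by (intro fundamental_theorem_of_calculus_interior_strong[where S = "{a}"])
      (use R R' in \<open>auto intro!: DF continuous_at_imp_continuous_on simp flip: has_real_derivative_iff_has_vector_derivative\<close>)
  then have "(LINT x|lborel. sgn (x - a) * deriv \<phi> x) = F R' - F (- R')"
    by (intro has_integral_imp_LINT[where R = R'] pairing_integrable ldom_sgn test_fn_deriv t) (use R' in auto)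
  also have "\<dots> = - 2 * \<phi> a"
    using R R' by (auto simp: F_def sgn_real_def)
  finally show ?thesis .
qed

text \<open>Since cosh = (cosh - 1) + 1, the jump is isolated in a pure sign function and the rest
  is a continuous entry of the ladder.\<close>

lemma sgn_tail_0_split: "sgn_tail 0 x = sgn_tail 2 x + 1/2 * sgn x"
  by (simp add: sgn_tail_def numeral_2_eq_2 right_diff_distrib)

lemma sgn_tail_0_pairing_deriv:
  assumes t: "test_fn \<phi>"
  shows "(LINT x|lborel. sgn_tail 0 (x - a) * deriv \<phi> x) = - \<phi> a - (LINT x|lborel. sgn_tail 1 (x - a) * \<phi> x)"
  using sgn_tail_pairing_iterate[OF t, of 1 1 a] sgn_pairing_deriv[OF t, of a]
  unfolding sgn_tail_0_split pairing_lincomb_left[OF ldom_sgn_tail_shift ldom_sgn test_fn_deriv[OF t]]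
  by (simp add: numeral_2_eq_2)

lemma pairing_diff_right:
  assumes "ldom u" "test_fn \<phi>"
  shows "(LINT x|lborel. u x * ((deriv ^^ j) \<phi> x - (deriv ^^ k) \<phi> x))
    = (LINT x|lborel. u x * (deriv ^^ j) \<phi> x) - (LINT x|lborel. u x * (deriv ^^ k) \<phi> x)"
  using pairing_lincomb_right[OF assms(1) test_fn_funpow_deriv[OF assms(2)] test_fn_funpow_deriv[OF assms(2)], where c = "-1"]
  by simp

text \<open>After 2m - 1 integrations by parts one derivative is left against
  \<open>sgn_tail 0\<close>; it produces the point value and a pairing with
  \<open>sgn_tail 1\<close>. The term of order 2m - 2 produces the same pairing, and the two
  cancel.\<close>

lemma sgn_tail_fundamental:
  assumes "m \<ge> 1" "test_fn \<phi>"
  shows "(LINT x|lborel. sgn_tail (2*m - 1) (x - a) * ((deriv ^^ (2*m)) \<phi> x - (deriv ^^ (2*m - 2)) \<phi> x)) = \<phi> a"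
proof -
  obtain n where m: "m = Suc n" using assms by (cases m) auto
  have "(LINT x|lborel. sgn_tail (Suc (2*n)) (x - a) * (deriv ^^ (Suc (2*n))) (deriv \<phi>) x)
      = \<phi> a + (LINT x|lborel. sgn_tail 1 (x - a) * \<phi> x)"
    using sgn_tail_pairing_iterate[OF test_fn_deriv[OF assms(2)], of "Suc (2*n)" 0 a] sgn_tail_0_pairing_deriv[OF assms(2)]
    by simp
  moreover have "(LINT x|lborel. sgn_tail (Suc (2*n)) (x - a) * (deriv ^^ (2*n)) \<phi> x) = (LINT x|lborel. sgn_tail 1 (x - a) * \<phi> x)"
    using sgn_tail_pairing_iterate[OF assms(2), of "2*n" 1 a] by simp
  ultimately show ?thesis
    unfolding m pairing_diff_right[OF ldom_sgn_tail_shift assms(2)]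
    by (simp add: funpow_Suc_right del: funpow.simps)
qed

text \<open>Integrating \<open>G\<close> over [0,1] brings in its primitive
  \<open>sgn_tail (2*m)\<close>. That primitive solves the equation with right-hand side sgn/2, and
  the difference of two shifts gives the indicator of [0,1].\<close>

lemma sgn_tail_even_pairing:
  assumes "m \<ge> 1" "test_fn \<phi>"
  shows "(LINT x|lborel. sgn_tail (2*m) (x - a) * ((deriv ^^ (2*m)) \<phi> x - (deriv ^^ (2*m - 2)) \<phi> x))
    = 1/2 * (LINT x|lborel. sgn (x - a) * \<phi> x)"
proof -
  obtain n where m: "m = Suc n" using assms by (cases m) auto
  have "(LINT x|lborel. sgn_tail (2*m) (x - a) * (deriv ^^ (2*m)) \<phi> x) = (LINT x|lborel. sgn_tail 0 (x - a) * \<phi> x)"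
    using sgn_tail_pairing_iterate[OF assms(2), of "2*m" 0 a] by simp
  moreover have "(LINT x|lborel. sgn_tail (2*m) (x - a) * (deriv ^^ (2*m - 2)) \<phi> x) = (LINT x|lborel. sgn_tail 2 (x - a) * \<phi> x)"
    using sgn_tail_pairing_iterate[OF assms(2), of "2*m-2" 2 a] m by simp
  ultimately show ?thesis
    unfolding pairing_diff_right[OF ldom_sgn_tail_shift assms(2)]
    using pairing_lincomb_left[OF ldom_sgn_tail_shift[of 2 a] ldom_sgn[of a] assms(2), of "1/2"]
    unfolding sgn_tail_0_split by simp
qed

section \<open>Convolution of the error functional with the fundamental solution\<close>

lemma ldom_set_integrable:
  assumes "ldom f" shows "set_integrable lborel {a..b} f"
proof -
  obtain F where F: "continuous_on UNIV F" "\<And>x. \<bar>f x\<bar> \<le> F x" and m: "f \<in> borel_measurable borel"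
    using assms unfolding ldom_def by metis
  have "set_integrable lborel {a..b} F"
    unfolding set_integrable_def
    by (intro borel_integrable_compact continuous_on_subset[OF F(1)]) auto
  then show ?thesis unfolding set_integrable_def
    by (rule Bochner_Integration.integrable_bound)
      (use m F(2) in \<open>auto intro!: AE_I2 mult_left_mono simp: abs_mult intro: order_trans[OF _ abs_ge_self]\<close>)
qed

lemma ldom_set_integral:
  assumes "ldom f" "(f has_integral I) {a..b}" shows "(LINT x:{a..b}|lborel. f x) = I"
  using set_borel_integral_eq_integral(2)[OF ldom_set_integrable[OF assms(1)], of a b] assms(2)
  by (simp add: integral_unique)

lemma sgn_tail_set_integral: "(LINT y:{0..1}|lborel. sgn_tail n (x - y)) = sgn_tail (Suc n) x - sgn_tail (Suc n) (x - 1)"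
proof (rule ldom_set_integral)
  show "ldom (\<lambda>y. sgn_tail n (x - y))" by (intro ldom_sgn_tail_comp continuous_intros)
  have "((\<lambda>y. sgn_tail n (x - y)) has_integral (- sgn_tail (Suc n) (x - 1) - (- sgn_tail (Suc n) (x - 0)))) {0..1}"
  proof (rule fundamental_theorem_of_calculus_interior_strong[where S = "{x}"])
    show "continuous_on {0..1} (\<lambda>y. - sgn_tail (Suc n) (x - y))"
      by (intro continuous_on_minus continuous_on_compose2[OF sgn_tail_continuous[of UNIV]] continuous_intros) auto
    show "((\<lambda>y. - sgn_tail (Suc n) (x - y)) has_vector_derivative sgn_tail n (x - y)) (at y)" if "y \<in> {0<..<1} - {x}" for y
      unfolding has_real_derivative_iff_has_vector_derivative[symmetric]
    proof -
      have "((\<lambda>y. x - y) has_real_derivative - 1) (at y)" by (auto intro!: derivative_eq_intros)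
      from DERIV_chain'[OF this sgn_tail_DERIV, of n] that
      have "((\<lambda>y. sgn_tail (Suc n) (x - y)) has_real_derivative - sgn_tail n (x - y)) (at y)" by auto
      then show "((\<lambda>y. - sgn_tail (Suc n) (x - y)) has_real_derivative sgn_tail n (x - y)) (at y)"
        using DERIV_minus by fastforce
    qed
  qed auto
  then show "((\<lambda>y. sgn_tail n (x - y)) has_integral sgn_tail (Suc n) x - sgn_tail (Suc n) (x - 1)) {0..1}" by simp
qed

text \<open>For a sequence \<open>F\<close> with \<open>(F (Suc n))' = F n\<close> this is the convolution of the error functional with \<open>F n\<close>.\<close>
definition ell_conv ::
  "nat \<Rightarrow> (nat \<Rightarrow> real) \<Rightarrow> (nat \<Rightarrow> real) \<Rightarrow> (nat \<Rightarrow> real \<Rightarrow> real) \<Rightarrow> nat \<Rightarrow> real \<Rightarrow> real" where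
  "ell_conv N C xs F n x = F (Suc n) x - F (Suc n) (x - 1) - (\<Sum>\<beta>=0..N. C \<beta> * F n (x - xs \<beta>))"

lemma ell_conv_G_eq: "m \<ge> 1 \<Longrightarrow> ell_conv_G m N C xs x = ell_conv N C xs sgn_tail (2*m - 1) x"
  by (simp add: ell_conv_G_def ell_conv_def G_eq_sgn_tail sgn_tail_set_integral)

lemma ldom_sum: "(\<And>i. i \<in> I \<Longrightarrow> ldom (f i)) \<Longrightarrow> ldom (\<lambda>x. \<Sum>i\<in>I. c i * f i x)"
proof (induction I rule: infinite_finite_induct)
  case (insert i I)
  then have "ldom (\<lambda>x. (\<Sum>i\<in>I. c i * f i x) + c i * f i x)" by (intro ldom_lincomb) auto
  then show ?case using insert by (simp add: add.commute)
qed (auto intro: continuous_imp_ldom)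

lemma ell_conv_sgn_tail_solves:
  assumes m: "m \<ge> 1" and t: "test_fn \<phi>"
  shows "(LINT x|lborel. ell_conv N C xs sgn_tail (2*m - 1) x * ((deriv ^^ (2*m)) \<phi> x - (deriv ^^ (2*m - 2)) \<phi> x))
    = ell_act N C xs \<phi>"
proof -
  define L where "L = (\<lambda>x. (deriv ^^ (2*m)) \<phi> x + (-1) * (deriv ^^ (2*m - 2)) \<phi> x)"
  have tL: "test_fn L" unfolding L_def by (intro test_fn_lincomb test_fn_funpow_deriv t)
  have I: "integrable lborel (\<lambda>x. sgn_tail n (x - a) * L x)" for n a
    by (intro pairing_integrable ldom_sgn_tail_shift tL)
  have "ell_conv N C xs sgn_tail (2*m - 1) x * L x
      = sgn_tail (2*m) (x - 0) * L x - sgn_tail (2*m) (x - 1) * L x - (\<Sum>\<beta>=0..N. C \<beta> * (sgn_tail (2*m - 1) (x - xs \<beta>) * L x))" for x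
    using m by (simp add: ell_conv_def ring_distribs sum_distrib_right mult.assoc)
  then have "(LINT x|lborel. ell_conv N C xs sgn_tail (2*m - 1) x * L x)
      = (LINT x|lborel. sgn_tail (2*m) (x - 0) * L x) - (LINT x|lborel. sgn_tail (2*m) (x - 1) * L x)
        - (\<Sum>\<beta>=0..N. C \<beta> * (LINT x|lborel. sgn_tail (2*m - 1) (x - xs \<beta>) * L x))"
    using I by (simp only: Bochner_Integration.integral_diff Bochner_Integration.integrable_diff
        Bochner_Integration.integral_sum Bochner_Integration.integrable_sum integrable_mult_right integral_mult_right_zero)
  also have "\<dots> = (1/2 * (LINT x|lborel. sgn (x - 0) * \<phi> x) - 1/2 * (LINT x|lborel. sgn (x - 1) * \<phi> x))
        - (\<Sum>\<beta>=0..N. C \<beta> * \<phi> (xs \<beta>))"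
    using sgn_tail_even_pairing[OF m t, of 0] sgn_tail_even_pairing[OF m t, of 1] sgn_tail_fundamental[OF m t] by (simp add: L_def)
  also have "1/2 * (LINT x|lborel. sgn (x - 0) * \<phi> x) - 1/2 * (LINT x|lborel. sgn (x - 1) * \<phi> x)
      = (LINT x|lborel. 1/2 * (sgn (x - 0) * \<phi> x) - 1/2 * (sgn (x - 1) * \<phi> x))"
    using pairing_integrable[OF ldom_sgn t, of 0] pairing_integrable[OF ldom_sgn t, of 1] by simp
  \<comment> \<open>Half the difference of the two signs is the indicator of [0,1] except at 0 and
    1, where it is 1/2; hence equality almost everywhere.\<close>
  also have "\<dots> = (LINT x:{0..1}|lborel. \<phi> x)"
    unfolding set_lebesgue_integral_def
  proof (rule integral_cong_AE)
    have "\<phi> \<in> borel_measurable borel"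
      using t by (intro borel_measurable_continuous_onI smooth_imp_continuous_on test_fn_smooth)
    then show "(\<lambda>x. 1/2 * (sgn (x - 0) * \<phi> x) - 1/2 * (sgn (x - 1) * \<phi> x)) \<in> borel_measurable lborel"
      "(\<lambda>x. indicator {0..1} x *\<^sub>R \<phi> x) \<in> borel_measurable lborel"
      using sgn_measurable[of 0] sgn_measurable[of 1] by measurable
    show "AE x in lborel. 1/2 * (sgn (x - 0) * \<phi> x) - 1/2 * (sgn (x - 1) * \<phi> x) = indicator {0..1} x *\<^sub>R \<phi> x"
      using AE_lborel_singleton[of 0] AE_lborel_singleton[of 1]
      by eventually_elim (auto simp: sgn_real_def indicator_def)
  qed
  finally show ?thesis by (simp add: ell_act_def L_def)
qed

lemma dist_solves_G: "m \<ge> 1 \<Longrightarrow> dist_solves m (G m) (\<lambda>\<phi>. \<phi> 0)"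
  unfolding dist_solves_def
proof (intro allI impI conjI)
  fix \<phi> assume m: "m \<ge> 1" and t: "test_fn \<phi>"
  have "test_fn (\<lambda>x. (deriv ^^ (2*m)) \<phi> x + (-1) * (deriv ^^ (2*m - 2)) \<phi> x)"
    by (intro test_fn_lincomb test_fn_funpow_deriv t)
  then show I: "integrable lborel (\<lambda>x. G m x * ((deriv ^^ (2*m)) \<phi> x - (deriv ^^ (2*m - 2)) \<phi> x))"
    using pairing_integrable[OF ldom_sgn_tail_shift[of "2*m-1" 0]] m by (simp add: G_eq_sgn_tail)
  then show "(\<lambda>x. G m x * ((deriv ^^ (2*m)) \<phi> x - (deriv ^^ (2*m - 2)) \<phi> x)) \<in> borel_measurable lborel"
    by (rule borel_measurable_integrable)
  show "(LINT x|lborel. G m x * ((deriv ^^ (2*m)) \<phi> x - (deriv ^^ (2*m - 2)) \<phi> x)) = \<phi> 0"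
    using sgn_tail_fundamental[OF m t, of 0] m by (simp add: G_eq_sgn_tail)
qed

lemma ell_conv_sgn_tail_continuous: "n \<ge> 1 \<Longrightarrow> continuous_on A (ell_conv N C xs sgn_tail n)"
  unfolding ell_conv_def
  by (cases n) (auto intro!: continuous_intros sgn_tail_shift_continuous sgn_tail_continuous)

lemma general_solution:
  assumes m: "m \<ge> 1" and cont: "continuous_on UNIV \<psi>"
    and ode: "dist_solves m \<psi> (\<lambda>\<phi>. (-1) ^ m * ell_act N C xs \<phi>)"
  obtains p a b where "\<And>x. \<psi> x = (-1) ^ m * ell_conv N C xs sgn_tail (2*m - 1) x + poly p x + a * exp x + b * exp (- x)"
    and "p = 0 \<or> degree p < 2*m - 2"
proof -
  let ?w = "ell_conv N C xs sgn_tail (2*m - 1)"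
  define u where "u = (\<lambda>x. \<psi> x + (- ((-1) ^ m)) * ?w x)"
  have cw: "continuous_on UNIV ?w" by (rule ell_conv_sgn_tail_continuous) (use m in simp)
  have "\<exists>p a b. (\<forall>x. u x = poly p x + a * exp x + b * exp (- x)) \<and> (p = 0 \<or> degree p < 2*m - 2)"
  proof (rule homogeneous_solution)
    show "continuous_on UNIV u" unfolding u_def by (intro continuous_intros cont cw)
    show "even (2*m - 2)" by simp
    fix \<phi> assume t: "test_fn \<phi>"
    have tL: "test_fn (\<lambda>x. (deriv ^^ (2*m)) \<phi> x + (-1) * (deriv ^^ (2*m - 2)) \<phi> x)"
      by (intro test_fn_lincomb test_fn_funpow_deriv t)
    have "(LINT x|lborel. u x * ((deriv ^^ (2*m)) \<phi> x - (deriv ^^ (2*m - 2)) \<phi> x)) = 0"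
      using pairing_lincomb_left[OF continuous_imp_ldom[OF cont] continuous_imp_ldom[OF cw] tL, of "- ((-1) ^ m)"]
        ell_conv_sgn_tail_solves[OF m t, of N C xs] ode t
      unfolding dist_solves_def u_def by simp
    moreover have "2*m - 2 + 2 = 2*m" using m by simp
    ultimately show "(LINT x|lborel. u x * ((deriv ^^ (2*m - 2 + 2)) \<phi> x - (deriv ^^ (2*m - 2)) \<phi> x)) = 0"
      by metis
  qed
  then obtain p a b where "\<And>x. u x = poly p x + a * exp x + b * exp (- x)" "p = 0 \<or> degree p < 2*m - 2"
    by blast
  then show ?thesis using that[of p a b] by (simp add: u_def algebra_simps)
qed

section \<open>Boundary conditions\<close>

text \<open>The remainder of exp after its Taylor terms of degree below n. It appears because D + 1
  adds two neighbouring entries of \<open>htail\<close>.\<close>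

definition exp_tail :: "nat \<Rightarrow> real \<Rightarrow> real" where
  "exp_tail n x = htail (Suc n) x + htail n x"

definition mono_fact :: "nat \<Rightarrow> real \<Rightarrow> real" where
  "mono_fact n x = x ^ n / fact n"

lemma mono_fact_DERIV: "(mono_fact (Suc n) has_real_derivative mono_fact n x) (at x)"
  using DERIV_cdivide[OF DERIV_pow[of "Suc n" x UNIV], of "fact (Suc n)"]
  by (simp add: mono_fact_def[abs_def] field_simps del: of_nat_Suc)

lemma exp_tail_0: "exp_tail 0 x = exp x"
  by (simp add: exp_tail_def sinh_field_def cosh_field_def field_simps)

lemma exp_tail_Suc: "exp_tail (Suc n) x = exp_tail n x - mono_fact n x"
  by (simp add: exp_tail_def mono_fact_def)

lemma ell_conv_DERIV:
  assumes "\<And>x. (F (Suc (Suc n)) has_real_derivative F (Suc n) x) (at x)"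
    and "\<And>x. (F (Suc n) has_real_derivative F n x) (at x)"
  shows "(ell_conv N C xs F (Suc n) has_real_derivative ell_conv N C xs F n x) (at x)"
proof -
  have "((\<lambda>x. F (Suc k) (x - a)) has_real_derivative F k (x - a)) (at x)"
    if "\<And>x. (F (Suc k) has_real_derivative F k x) (at x)" for a x k
    using DERIV_shift[of "F (Suc k)" "F k (x - a)" x "- a"] that by simp
  then show ?thesis
    unfolding ell_conv_def[abs_def] using assms
    by (intro DERIV_diff DERIV_sum DERIV_cmult) auto
qed

text \<open>Two derivatives lower the index by two, so D^2 - 1 leaves the convolution with x^n/n!, a
  polynomial whose coefficients are built from moments of the functional.\<close>

lemma ell_conv_htail_Suc_Suc:
  "ell_conv N C xs htail (Suc (Suc n)) x
    = ell_conv N C xs htail n x - ell_conv N C xs mono_fact n x"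
  by (simp add: ell_conv_def mono_fact_def algebra_simps sum_subtractf del: power_Suc fact_Suc)

lemma ell_conv_exp_tail:
  "ell_conv N C xs exp_tail n x = ell_conv N C xs htail (Suc n) x + ell_conv N C xs htail n x"
  by (simp add: ell_conv_def exp_tail_def algebra_simps sum.distrib del: htail.simps)

lemma ell_conv_exp_tail_Suc:
  "ell_conv N C xs exp_tail (Suc n) x = ell_conv N C xs exp_tail n x - ell_conv N C xs mono_fact n x"
  unfolding ell_conv_def exp_tail_Suc by (simp add: algebra_simps sum_subtractf)

text \<open>From e^(x-y) = e^x e^(-y) the variable x factors out; the constant that remains is the
  error functional applied to e^(-y).\<close>

lemma ell_conv_exp_tail_0:
  "ell_conv N C xs exp_tail 0 x = exp x * ell_conv N C xs exp_tail 0 0"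
proof -
  have "exp (x - y) = exp x * exp (0 - y)" for y :: real by (simp flip: exp_add)
  then show ?thesis
    by (simp add: ell_conv_def exp_tail_Suc exp_tail_0 mono_fact_def algebra_simps sum_distrib_left)
qed

lemma sequence_zero:
  fixes R :: "nat \<Rightarrow> real \<Rightarrow> real"
  assumes "\<And>i x. i < n \<Longrightarrow> (R i has_real_derivative R (Suc i) x) (at x)"
    and "\<And>x. R n x = 0" and "\<And>i. i < n \<Longrightarrow> R i c = 0" and "i \<le> n"
  shows "R i x = 0"
  using assms(4)
proof (induction arbitrary: x rule: inc_induct)
  case (step i)
  then have "\<And>x. (R i has_real_derivative 0) (at x)" using assms(1)[of i] by simp
  then have "R i x = R i c" by (metis DERIV_isconst_all)
  then show ?case using assms(3) step by simp
qed (rule assms(2))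

lemma pderiv_funpow_eq_0_iff:
  fixes p :: "real poly"
  shows "(pderiv ^^ n) p = 0 \<longleftrightarrow> p = 0 \<or> degree p < n"
proof (induction n arbitrary: p)
  case (Suc n)
  have "(pderiv ^^ Suc n) p = 0 \<longleftrightarrow> pderiv p = 0 \<or> degree (pderiv p) < n"
    using Suc[of "pderiv p"] by (simp add: funpow_Suc_right del: funpow.simps)
  then show ?case by (cases "degree p") (auto simp: pderiv_eq_0_iff degree_pderiv)
qed simp

lemma poly_eq_second_pderiv:
  fixes p :: "real poly"
  assumes "pderiv (pderiv p) = p" shows "p = 0"
proof (rule ccontr)
  assume "p \<noteq> 0"
  moreover have "degree p = degree p - 1 - 1"
    using arg_cong[OF assms, of degree] by (simp add: degree_pderiv)
  then have "degree p = 0" by linarith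
  then have "pderiv p = 0" by (simp add: pderiv_eq_0_iff)
  ultimately show False using assms by simp
qed

lemma funpow_pderiv_diff:
  fixes p q :: "real poly"
  shows "(pderiv ^^ n) (p - q) = (pderiv ^^ n) p - (pderiv ^^ n) q"
  by (induction n) (simp_all add: pderiv_diff)

text \<open>Iterated \<open>deriv\<close> at a point depends only on values nearby. This evaluates
  the derivatives of \<psi> in the boundary conditions on the two outer half-lines, where an
  explicit formula with known derivatives holds.\<close>

lemma funpow_deriv_eq_on_open:
  assumes U: "open U" and eq: "\<And>x. x \<in> U \<Longrightarrow> f x = F 0 x"
    and D: "\<And>i x. i < k \<Longrightarrow> x \<in> U \<Longrightarrow> (F i has_real_derivative F (Suc i) x) (at x)" and x: "x \<in> U"
  shows "(deriv ^^ k) f x = F k x"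
  using D x
proof (induction k arbitrary: x)
  case (Suc k)
  have "((deriv ^^ k) f has_real_derivative F (Suc k) x) (at x)"
    by (rule has_field_derivative_transform_within_open[OF Suc.prems(1) U])
      (use Suc in auto)
  then show ?case by (simp add: DERIV_imp_deriv)
qed (use eq in auto)

context
  fixes m n N :: nat and C xs :: "nat \<Rightarrow> real" and \<psi> :: "real \<Rightarrow> real"
    and p :: "real poly" and a b :: real
  assumes m: "m = Suc n"
    and nodes: "\<forall>\<beta>\<le>N. xs \<beta> \<in> {0..1}"
    and \<psi>: "\<And>x. \<psi> x = (-1) ^ m * ell_conv N C xs sgn_tail (2*m - 1) x + poly p x + a * exp x + b * exp (- x)"
begin

text \<open>The \<open>i\<close>-th derivative of \<open>\<psi>\<close> to the left of \<open>0\<close> for \<open>\<sigma> = - (-1)\<^sup>m / 2\<close>, to the right of \<open>1\<close>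
  for \<open>\<sigma> = (-1)\<^sup>m / 2\<close>.\<close>
definition outer :: "real \<Rightarrow> nat \<Rightarrow> real \<Rightarrow> real" where
  "outer \<sigma> i x = \<sigma> * ell_conv N C xs htail (2*m - 1 - i) x
      + poly ((pderiv ^^ i) p) x + a * exp x + (-1) ^ i * b * exp (- x)"

lemma outer_DERIV:
  assumes "i < 2*m - 1" shows "(outer \<sigma> i has_real_derivative outer \<sigma> (Suc i) x) (at x)"
proof -
  have "2*m - 1 - i = Suc (2*m - 1 - Suc i)" using assms by simp
  then have "(ell_conv N C xs htail (2*m - 1 - i) has_real_derivative ell_conv N C xs htail (2*m - 1 - Suc i) x) (at x)"
    using ell_conv_DERIV[of htail] htail_DERIV by metis
  then show ?thesis unfolding outer_def[abs_def]
    by (auto intro!: derivative_eq_intros poly_DERIV)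
qed

lemma outer_isCont: "isCont (outer \<sigma> i) x"
proof -
  have "isCont (\<lambda>x. htail k (x - y)) x" for k y
    by (intro continuous_at_compose[of x "\<lambda>x. x - y" "htail k", unfolded o_def] continuous_intros)
      (use htail_continuous[of UNIV k] in \<open>simp add: continuous_on_eq_continuous_at\<close>)
  from this[of _ 0] this show ?thesis unfolding outer_def[abs_def] ell_conv_def
    by (auto intro!: continuous_intros)
qed

lemma outer_left: "x < 0 \<Longrightarrow> \<psi> x = outer (- ((-1) ^ m / 2)) 0 x"
proof -
  assume "x < 0"
  then have "sgn_tail k x = - 1/2 * htail k x" "sgn_tail k (x - 1) = - 1/2 * htail k (x - 1)"
    "\<beta> \<le> N \<Longrightarrow> sgn_tail k (x - xs \<beta>) = - 1/2 * htail k (x - xs \<beta>)" for k \<beta>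
    using nodes by (auto simp: sgn_tail_def sgn_real_def)
  then have "ell_conv N C xs sgn_tail (2*m - 1) x = - 1/2 * ell_conv N C xs htail (2*m - 1) x"
    unfolding ell_conv_def by (simp add: algebra_simps sum_distrib_left sum_negf)
  then show ?thesis unfolding \<psi> outer_def by simp
qed

lemma outer_right: "x > 1 \<Longrightarrow> \<psi> x = outer ((-1) ^ m / 2) 0 x"
proof -
  assume "x > 1"
  then have "sgn_tail k x = 1/2 * htail k x" "sgn_tail k (x - 1) = 1/2 * htail k (x - 1)"
    "\<beta> \<le> N \<Longrightarrow> sgn_tail k (x - xs \<beta>) = 1/2 * htail k (x - xs \<beta>)" for k \<beta>
    using nodes by (auto simp: sgn_tail_def sgn_real_def)
  then have "ell_conv N C xs sgn_tail (2*m - 1) x = 1/2 * ell_conv N C xs htail (2*m - 1) x"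
    unfolding ell_conv_def by (simp add: algebra_simps sum_distrib_left)
  then show ?thesis unfolding \<psi> outer_def by simp
qed

text \<open>The formulas valid on the outer half-lines extend continuously across 0 and 1, so the
  limits in the boundary conditions are values of \<open>outer\<close>, with opposite \<sigma> at
  the two ends.\<close>

lemma outer_boundary:
  assumes v: "vanishes_at_ends (\<lambda>t. (deriv ^^ i) \<psi> t + c * (deriv ^^ j) \<psi> t)"
    and i: "i \<le> 2*m - 1" and j: "j \<le> 2*m - 1"
  shows "outer (- ((-1) ^ m / 2)) i 0 + c * outer (- ((-1) ^ m / 2)) j 0 = 0"
    and "outer ((-1) ^ m / 2) i 1 + c * outer ((-1) ^ m / 2) j 1 = 0"
proof -
  have L: "(deriv ^^ k) \<psi> x = outer (- ((-1) ^ m / 2)) k x" if "x < 0" "k \<le> 2*m - 1" for k x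
    by (rule funpow_deriv_eq_on_open[of "{..<0}"]) (use that in \<open>auto intro: outer_left outer_DERIV\<close>)
  have R: "(deriv ^^ k) \<psi> x = outer ((-1) ^ m / 2) k x" if "x > 1" "k \<le> 2*m - 1" for k x
    by (rule funpow_deriv_eq_on_open[of "{1<..}"]) (use that in \<open>auto intro: outer_right outer_DERIV\<close>)
  have T: "((\<lambda>t. outer \<sigma> i t + c * outer \<sigma> j t) \<longlongrightarrow> outer \<sigma> i x + c * outer \<sigma> j x) (at x within U)" for \<sigma> x U
    using outer_isCont unfolding isCont_def
    by (intro tendsto_intros) (auto intro: tendsto_within_subset)
  have "((\<lambda>t. outer (- ((-1) ^ m / 2)) i t + c * outer (- ((-1) ^ m / 2)) j t) \<longlongrightarrow> 0) (at_left 0)"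
  proof (rule Lim_transform_eventually)
    show "\<forall>\<^sub>F t in at_left 0. (deriv ^^ i) \<psi> t + c * (deriv ^^ j) \<psi> t
        = outer (- ((-1) ^ m / 2)) i t + c * outer (- ((-1) ^ m / 2)) j t"
      unfolding eventually_at_filter by (rule always_eventually) (simp add: L[OF _ i] L[OF _ j])
  qed (use v in \<open>simp add: vanishes_at_ends_def\<close>)
  then show "outer (- ((-1) ^ m / 2)) i 0 + c * outer (- ((-1) ^ m / 2)) j 0 = 0"
    using tendsto_unique[OF trivial_limit_at_left_real T] by blast
  have "((\<lambda>t. outer ((-1) ^ m / 2) i t + c * outer ((-1) ^ m / 2) j t) \<longlongrightarrow> 0) (at_right 1)"
  proof (rule Lim_transform_eventually)
    show "\<forall>\<^sub>F t in at_right 1. (deriv ^^ i) \<psi> t + c * (deriv ^^ j) \<psi> t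
        = outer ((-1) ^ m / 2) i t + c * outer ((-1) ^ m / 2) j t"
      unfolding eventually_at_filter by (rule always_eventually) (simp add: R[OF _ i] R[OF _ j])
  qed (use v in \<open>simp add: vanishes_at_ends_def\<close>)
  then show "outer ((-1) ^ m / 2) i 1 + c * outer ((-1) ^ m / 2) j 1 = 0"
    using tendsto_unique[OF trivial_limit_at_right_real T] by blast
qed

text \<open>Applying D^2 - 1 to \<open>outer\<close> gives a ladder of polynomials \<open>R\<close>
  that ends in 0 because the degree of p is below 2n. Its zero data, at 0 for one sign and at 1 for
  the other, make both ladders vanish identically. Their sum isolates the part from p, their
  difference the part from the functional.\<close>

lemma boundary_consequences:
  assumes deg: "p = 0 \<or> degree p < 2*m - 2"
    and bc1: "\<forall>s\<in>{1..m-1}. vanishes_at_ends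
                 (\<lambda>t. (deriv ^^ (m + s)) \<psi> t - (deriv ^^ (m + s - 2)) \<psi> t)"
    and bc2: "vanishes_at_ends (\<lambda>t. (deriv ^^ m) \<psi> t + (deriv ^^ (m - 1)) \<psi> t)"
  shows "p = 0 \<or> degree p < n" and "a = 0"
    and "\<And>k x. k < n \<Longrightarrow> ell_conv N C xs mono_fact k x = 0"
    and "\<And>k x. k \<le> n \<Longrightarrow> ell_conv N C xs exp_tail k x = 0"
proof -
  define c :: real where "c = (-1) ^ m / 2"
  have c0: "c \<noteq> 0" by (simp add: c_def)
  define r where "r = pderiv (pderiv p) - p"
  \<comment> \<open>The convolution with x^(n-1)/(n-1)! has degree at most n - 1, so its n-th
    derivative is 0. Truncated subtraction would give index 0 at i = n instead, hence the case
    distinction.\<close>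
  define R where "R = (\<lambda>\<sigma> i x. (if i < n then \<sigma> * ell_conv N C xs mono_fact (n - 1 - i) x else 0)
      + poly ((pderiv ^^ (n + i)) r) x)"
  have p0: "(pderiv ^^ (n + n)) p = 0" using deg m by (simp add: pderiv_funpow_eq_0_iff mult_2)
  have r0: "(pderiv ^^ (n + n)) r = 0"
  proof -
    have "(pderiv ^^ (n + n)) (pderiv (pderiv p)) = pderiv (pderiv ((pderiv ^^ (n + n)) p))"
      by (simp add: funpow_swap1)
    then show ?thesis by (simp add: r_def funpow_pderiv_diff p0)
  qed
  have mono_const: "(ell_conv N C xs mono_fact 0 has_real_derivative 0) (at x)" for x
    unfolding ell_conv_def[abs_def] mono_fact_def by (auto intro!: derivative_eq_intros)
  have RD: "(R \<sigma> i has_real_derivative R \<sigma> (Suc i) x) (at x)" if "i < n" for \<sigma> i x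
  proof (cases "Suc i < n")
    case True
    have "n - 1 - i = Suc (n - 1 - Suc i)" using True by simp
    then have "(ell_conv N C xs mono_fact (n - 1 - i) has_real_derivative ell_conv N C xs mono_fact (n - 1 - Suc i) x) (at x)"
      using ell_conv_DERIV[of mono_fact] mono_fact_DERIV by metis
    then show ?thesis using True that unfolding R_def by (auto intro!: derivative_eq_intros poly_DERIV)
  next
    case False
    then have "n - 1 - i = 0" by simp
    then show ?thesis using False that mono_const unfolding R_def
      by (auto intro!: derivative_eq_intros poly_DERIV)
  qed
  have Rn: "R \<sigma> n x = 0" for \<sigma> x by (simp add: R_def r0)
  have outer_diff: "outer \<sigma> (m + Suc i) x + (-1) * outer \<sigma> (m + Suc i - 2) x = R \<sigma> i x" if "i < n" for \<sigma> i x
  proof -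
    have e: "2*m - 1 - (m + Suc i - 2) = Suc (Suc (n - 1 - i))" "2*m - 1 - (m + Suc i) = n - 1 - i"
      "m + Suc i - 2 = n + i" "m + Suc i = Suc (Suc (n + i))"
      using that m by auto
    have "poly ((pderiv ^^ (n + i)) r) x = poly ((pderiv ^^ Suc (Suc (n + i))) p) x - poly ((pderiv ^^ (n + i)) p) x"
      unfolding r_def funpow_pderiv_diff by (simp add: funpow_swap1)
    then show ?thesis using that
      unfolding outer_def unfolding e(1) unfolding e(2) unfolding e(3) unfolding e(4) ell_conv_htail_Suc_Suc R_def
      by (simp add: algebra_simps)
  qed
  have bnd: "R (- c) i 0 = 0 \<and> R c i 1 = 0" if "i < n" for i
  proof -
    have "vanishes_at_ends (\<lambda>t. (deriv ^^ (m + Suc i)) \<psi> t + (-1) * (deriv ^^ (m + Suc i - 2)) \<psi> t)"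
      using bspec[OF bc1, of "Suc i"] that m by simp
    moreover have "m + Suc i \<le> 2*m - 1" "m + Suc i - 2 \<le> 2*m - 1" using that m by auto
    ultimately show ?thesis
      using outer_boundary[of "m + Suc i" "-1" "m + Suc i - 2"] unfolding outer_diff[OF that] c_def by simp
  qed
  have Rz: "R (- c) i x = 0" "R c i x = 0" if "i \<le> n" for i x
    by (rule sequence_zero[OF RD Rn _ that, where c = 0], simp_all add: bnd)
      (rule sequence_zero[OF RD Rn _ that, where c = 1], simp_all add: bnd)
  show mz: "ell_conv N C xs mono_fact k x = 0" if "k < n" for k x
    using Rz[of "n - 1 - k" x] that c0 by (auto simp: R_def)
  have "poly ((pderiv ^^ n) r) x = 0" for x
    using Rz[of 0 x] by (auto simp: R_def split: if_splits)
  then have "(pderiv ^^ n) r = 0" using poly_all_0_iff_0 by blast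
  then have "pderiv (pderiv ((pderiv ^^ n) p)) = (pderiv ^^ n) p"
    unfolding r_def funpow_pderiv_diff by (simp add: funpow_swap1)
  then have pn: "(pderiv ^^ n) p = 0" by (rule poly_eq_second_pderiv)
  then show "p = 0 \<or> degree p < n" by (simp add: pderiv_funpow_eq_0_iff)
  have Ek: "ell_conv N C xs exp_tail k x = ell_conv N C xs exp_tail 0 x" if "k \<le> n" for k x
    using that by (induction k) (simp_all add: ell_conv_exp_tail_Suc mz)
  \<comment> \<open>Under D + 1 the e^(-x) terms cancel, p disappears because its n-th derivative is
    0, and e^x doubles. Vanishing moments reduce \<open>exp_tail n\<close> to
    \<open>exp_tail 0\<close>, that is, to a multiple of e^x.\<close>
  have os: "outer \<sigma> m x + 1 * outer \<sigma> (m - 1) x = exp x * (\<sigma> * ell_conv N C xs exp_tail 0 0 + 2 * a)" for \<sigma> x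
  proof -
    have "2 * m - 1 - m = n" "2 * m - 1 - (m - 1) = Suc n" using m by auto
    then have "outer \<sigma> m x + 1 * outer \<sigma> (m - 1) x = \<sigma> * ell_conv N C xs exp_tail n x + 2 * a * exp x"
      unfolding outer_def ell_conv_exp_tail using pn by (simp add: m algebra_simps)
    then show ?thesis unfolding Ek[OF order_refl] by (subst (asm) ell_conv_exp_tail_0) (simp add: algebra_simps)
  qed
  have "vanishes_at_ends (\<lambda>t. (deriv ^^ m) \<psi> t + 1 * (deriv ^^ (m - 1)) \<psi> t)" using bc2 by simp
  \<comment> \<open>The nonzero exponential factor drops out, leaving two equations that differ only
    in the sign of c; since c is nonzero, both unknowns vanish.\<close>
  from outer_boundary[OF this] have "- c * ell_conv N C xs exp_tail 0 0 + 2 * a = 0" "c * ell_conv N C xs exp_tail 0 0 + 2 * a = 0"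
    unfolding os c_def using m by simp_all
  then have a: "a = 0" and e0: "ell_conv N C xs exp_tail 0 0 = 0" using c0 by auto
  show "a = 0" by (rule a)
  show "ell_conv N C xs exp_tail k x = 0" if "k \<le> n" for k x
    unfolding Ek[OF that] by (subst ell_conv_exp_tail_0) (simp add: e0)
qed

end

section \<open>Uniqueness of the derivatives and a Fubini theorem on triangles\<close>

text \<open>Rays form an intersection-stable generator of the Borel sets, and the sets over which
  \<open>D\<close> integrates to 0 are closed under complements and countable disjoint unions. So
  all Borel integrals vanish, and a density is determined by them almost everywhere.\<close>

lemma AE_zero_of_initial_integrals:
  fixes d :: "real \<Rightarrow> real"
  assumes int: "set_integrable lborel {0..1} d"
    and z: "\<And>x. x \<in> {0..1} \<Longrightarrow> (LINT t:{0..x}|lborel. d t) = 0"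
  shows "AE t in lborel. t \<in> {0..1} \<longrightarrow> d t = 0"
proof -
  define D where "D = (\<lambda>t. indicator {0..1} t * d t)"
  have ID: "integrable lborel D" using int by (simp add: D_def set_integrable_def)
  have IA: "set_integrable lborel A D" if "A \<in> sets borel" for A
    unfolding set_integrable_def using integrable_mult_indicator[OF _ ID, of A] that by simp
  have ray: "(LINT t:{..x}|lborel. D t) = 0" for x
  proof -
    have "(LINT t:{..x}|lborel. D t) = (LINT t:{0..min x 1}|lborel. d t)"
      unfolding set_lebesgue_integral_def D_def
      by (rule Bochner_Integration.integral_cong) (auto simp: indicator_def)
    also have "\<dots> = 0" using z[of "min x 1"] by (cases "x < 0") (auto simp: set_lebesgue_integral_def)
    finally show ?thesis .
  qed
  have whole: "(LINT t:UNIV|lborel. D t) = 0"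
  proof -
    have "(LINT t:UNIV|lborel. D t) = (LINT t:{..1}|lborel. D t)"
      unfolding set_lebesgue_integral_def D_def
      by (rule Bochner_Integration.integral_cong) (auto simp: indicator_def)
    then show ?thesis by (simp add: ray)
  qed
  \<comment> \<open>Measurability is carried along in the induction because additivity of the
    integral needs \<open>D\<close> integrable over the sets involved.\<close>
  have "A \<in> sets borel \<and> (LINT t:A|lborel. D t) = 0" if "A \<in> sets borel" for A
  proof -
    have stable: "Int_stable (range (\<lambda>a::real. {..a}))"
      by (auto simp: Int_stable_def)
    have "range (\<lambda>a::real. {..a}) \<subseteq> Pow UNIV" "A \<in> sigma_sets UNIV (range (\<lambda>a::real. {..a}))"
      using that by (auto simp: borel_eq_atMost)
    with stable show ?thesis
    proof (induction A rule: sigma_sets_induct_disjoint)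
      case (basic A)
      then show ?case using ray by auto
    next
      case (compl A)
      have "(LINT t:UNIV - A \<union> A|lborel. D t) = (LINT t:UNIV - A|lborel. D t) + (LINT t:A|lborel. D t)"
        by (rule set_integral_Un) (use compl IA in auto)
      then show ?case using compl whole by (auto simp: Un_commute)
    next
      case (union A)
      have "(LINT t:(\<Union>i. A i)|lborel. D t) = (\<Sum>i. (LINT t:(A i)|lborel. D t))"
      proof (rule lebesgue_integral_countable_add)
        have "(\<Union>i. A i) \<in> sets borel" using union.IH by blast
        then show "set_integrable lborel (\<Union>i. A i) D" by (rule IA)
      qed (use union in \<open>auto simp: disjoint_family_on_def\<close>)
      then show ?case using union by auto
    qed (auto simp: set_lebesgue_integral_def)
  qed
  then have "AE t in lborel. D t = 0" by (intro density_unique_real ID) (auto simp: set_lebesgue_integral_def)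
  then show ?thesis by eventually_elim (auto simp: D_def)
qed

lemma continuous_AE_zero:
  fixes f :: "real \<Rightarrow> real"
  assumes c: "continuous_on {0..1} f" and ae: "AE t in lborel. t \<in> {0..1} \<longrightarrow> f t = 0" and x: "x \<in> {0..1}"
  shows "f x = 0"
proof -
  have int: "set_integrable lborel {0..1} (\<lambda>t. \<bar>f t\<bar>)"
    unfolding set_integrable_def by (intro borel_integrable_compact continuous_intros c) auto
  have "(LINT t:{0..1}|lborel. \<bar>f t\<bar>) = 0"
    unfolding set_lebesgue_integral_def
  proof (rule integral_eq_zero_AE)
    show "AE t in lborel. indicator {0..1} t *\<^sub>R \<bar>f t\<bar> = 0"
      using ae by eventually_elim (auto simp: indicator_def)
  qed
  then have "integral {0..1} (\<lambda>t. \<bar>f t\<bar>) = 0"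
    using set_borel_integral_eq_integral(2)[OF int] by simp
  then have "((\<lambda>t. \<bar>f t\<bar>) has_integral 0) (cbox 0 1)"
    using set_borel_integral_eq_integral(1)[OF int] by (simp add: has_integral_iff)
  then have "\<bar>f x\<bar> = 0"
    by (rule has_integral_0_cbox_imp_0[rotated 2]) (use c x in \<open>auto intro!: continuous_intros\<close>)
  then show ?thesis by simp
qed

lemma W_derivs_integrable:
  "W_derivs m \<phi> g \<Longrightarrow> k < m \<Longrightarrow> set_integrable lborel {0..1} (g (Suc k))"
  unfolding W_derivs_def by blast

lemma W_derivs_integral:
  "W_derivs m \<phi> g \<Longrightarrow> k < m \<Longrightarrow> x \<in> {0..1} \<Longrightarrow>
    g k x = g k 0 + (LINT t:{0..x}|lborel. g (Suc k) t)"
  unfolding W_derivs_def by blast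

lemma W_derivs_continuous:
  assumes W: "W_derivs m \<phi> g" and k: "k < m"
  shows "continuous_on {0..1} (g k)"
proof -
  have int: "set_integrable lborel {0..x} (g (Suc k))" if "x \<in> {0..1}" for x
    using that by (intro set_integrable_subset[OF W_derivs_integrable[OF W k]]) auto
  have "continuous_on {0..1} (\<lambda>x. g k 0 + integral {0..x} (g (Suc k)))"
    using set_borel_integral_eq_integral(1)[OF int, of 1]
    by (intro continuous_intros indefinite_integral_continuous_1) auto
  then show ?thesis
  proof (rule continuous_on_eq)
    fix x :: real assume x: "x \<in> {0..1}"
    show "g k 0 + integral {0..x} (g (Suc k)) = g k x"
      unfolding W_derivs_integral[OF W k x] set_borel_integral_eq_integral(2)[OF int[OF x]] ..
  qed
qed

text \<open>Equal functions have equal increments, hence equal integrands almost everywhere; below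
  order m continuity upgrades this to every point. It makes the choice by \<open>SOME\<close> in
  \<open>W_norm\<close> immaterial.\<close>

lemma W_derivs_unique:
  assumes g: "W_derivs m \<phi> g" and h: "W_derivs m \<phi> h"
  shows "k < m \<Longrightarrow> x \<in> {0..1} \<Longrightarrow> g k x = h k x"
    and "m \<ge> 1 \<Longrightarrow> AE t in lborel. t \<in> {0..1} \<longrightarrow> g m t = h m t"
proof -
  have step: "AE t in lborel. t \<in> {0..1} \<longrightarrow> g (Suc k) t - h (Suc k) t = 0"
    if k: "k < m" and eq: "\<And>x. x \<in> {0..1} \<Longrightarrow> g k x = h k x" for k
  proof (rule AE_zero_of_initial_integrals)
    note I = W_derivs_integrable[OF g k] W_derivs_integrable[OF h k]
    show "set_integrable lborel {0..1} (\<lambda>t. g (Suc k) t - h (Suc k) t)"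
      using I by (rule set_integral_diff)
    fix x :: real assume x: "x \<in> {0..1}"
    have I': "set_integrable lborel {0..x} (g (Suc k))" "set_integrable lborel {0..x} (h (Suc k))"
      using x by (auto intro!: set_integrable_subset[OF I(1)] set_integrable_subset[OF I(2)])
    have "(LINT t:{0..x}|lborel. g (Suc k) t) = (LINT t:{0..x}|lborel. h (Suc k) t)"
      using W_derivs_integral[OF g k x] W_derivs_integral[OF h k x] eq[OF x] eq[of 0] by simp
    then show "(LINT t:{0..x}|lborel. g (Suc k) t - h (Suc k) t) = 0"
      using set_integral_diff(2)[OF I'] by simp
  qed
  have low: "k < m \<Longrightarrow> x \<in> {0..1} \<Longrightarrow> g k x = h k x" for k x
  proof (induction k arbitrary: x)
    case 0
    then show ?case using g h unfolding W_derivs_def by metis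
  next
    case (Suc k)
    have "g (Suc k) x - h (Suc k) x = 0"
      by (rule continuous_AE_zero[OF _ step])
        (use Suc in \<open>auto intro!: continuous_intros W_derivs_continuous[OF g] W_derivs_continuous[OF h]\<close>)
    then show ?case by simp
  qed
  then show "k < m \<Longrightarrow> x \<in> {0..1} \<Longrightarrow> g k x = h k x" .
  show "AE t in lborel. t \<in> {0..1} \<longrightarrow> g m t = h m t" if "m \<ge> 1"
    using step[of "m - 1"] low that by simp
qed

lemma W_norm_eq:
  assumes W: "W_derivs m \<phi> g" and m: "m \<ge> 1"
  shows "W_norm m \<phi> = sqrt (LINT t:{0..1}|lborel. (g m t + g (m - 1) t)\<^sup>2)"
proof -
  define h where "h = (SOME g. W_derivs m \<phi> g)"
  have h: "W_derivs m \<phi> h" unfolding h_def by (rule someI[of "W_derivs m \<phi>", OF W])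
  have meas: "(\<lambda>t. indicator {0..1} t * f m t) \<in> borel_measurable lborel"
    "(\<lambda>t. indicator {0..1} t * f (m - 1) t) \<in> borel_measurable lborel" if "W_derivs m \<phi> f" for f
  proof -
    show "(\<lambda>t. indicator {0..1} t * f m t) \<in> borel_measurable lborel"
      using W_derivs_integrable[OF that, of "m - 1"] m by (auto simp: set_integrable_def)
    have "set_integrable lborel {0..1} (f (m - 1))"
      unfolding set_integrable_def
      by (intro borel_integrable_compact W_derivs_continuous[OF that]) (use m in auto)
    then show "(\<lambda>t. indicator {0..1} t * f (m - 1) t) \<in> borel_measurable lborel"
      by (auto simp: set_integrable_def)
  qed
  have eq: "indicator {0..1} t *\<^sub>R (f m t + f (m - 1) t)\<^sup>2
      = (indicator {0..1} t * f m t + indicator {0..1} t * f (m - 1) t)\<^sup>2" for f :: "nat \<Rightarrow> real \<Rightarrow> real" and t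
    by (auto simp: indicator_def)
  have "(LINT t:{0..1}|lborel. (h m t + h (m - 1) t)\<^sup>2) = (LINT t:{0..1}|lborel. (g m t + g (m - 1) t)\<^sup>2)"
    unfolding set_lebesgue_integral_def
  proof (rule integral_cong_AE)
    show "(\<lambda>t. indicator {0..1} t *\<^sub>R (h m t + h (m - 1) t)\<^sup>2) \<in> borel_measurable lborel"
      unfolding eq using meas[OF h] by measurable
    show "(\<lambda>t. indicator {0..1} t *\<^sub>R (g m t + g (m - 1) t)\<^sup>2) \<in> borel_measurable lborel"
      unfolding eq using meas[OF W] by measurable
    show "AE t in lborel. indicator {0..1} t *\<^sub>R (h m t + h (m - 1) t)\<^sup>2 = indicator {0..1} t *\<^sub>R (g m t + g (m - 1) t)\<^sup>2"
      using W_derivs_unique(2)[OF h W m]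
      by eventually_elim (use W_derivs_unique(1)[OF h W, of "m - 1"] m in \<open>auto simp: indicator_def\<close>)
  qed
  then show ?thesis by (simp add: W_norm_def h_def[symmetric])
qed

text \<open>The kernel is bounded on the compact square, so a constant times |f| dominates the
  integrand. The second conclusion is what permits splitting integrals that contain the inner
  one.\<close>

lemma triangle_Fubini:
  fixes k :: "real \<Rightarrow> real \<Rightarrow> real" and f :: "real \<Rightarrow> real"
  assumes k: "continuous_on UNIV (\<lambda>(s, t). k s t)" and f: "set_integrable lborel {0..y} f"
  shows "(LINT s:{0..y}|lborel. (LINT t:{0..s}|lborel. k s t * f t))
      = (LINT t:{0..y}|lborel. (LINT s:{t..y}|lborel. k s t) * f t)" (is ?eq)
    and "set_integrable lborel {0..y} (\<lambda>s. LINT t:{0..s}|lborel. k s t * f t)" (is ?int)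
proof -
  \<comment> \<open>Only the restriction of \<open>f\<close> to the interval is known to be
    measurable, so its extension by zero takes its place.\<close>
  define h where "h = (\<lambda>t. indicator {0..y} t * f t)"
  have h: "integrable lborel h" using f by (simp add: h_def set_integrable_def)
  then have [measurable]: "h \<in> borel_measurable borel" by (auto dest: borel_measurable_integrable)
  have [measurable]: "case_prod k \<in> borel_measurable (borel \<Otimes>\<^sub>M borel)"
    using borel_measurable_continuous_onI[OF k] by (simp add: borel_prod)
  \<comment> \<open>The cutoff to the triangle 0 \<le> t \<le> s \<le> y moves the variable limits
    into the integrand and makes this an ordinary product integral.\<close>
  define F where "F = (\<lambda>s t. indicator {p. 0 \<le> snd p \<and> snd p \<le> fst p \<and> fst p \<le> y} (s, t) * (k s t * h t))"
  have [measurable]: "case_prod F \<in> borel_measurable (borel \<Otimes>\<^sub>M borel)"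
    unfolding F_def by measurable
  obtain B where B: "\<And>s t. s \<in> {0..y} \<Longrightarrow> t \<in> {0..y} \<Longrightarrow> \<bar>k s t\<bar> \<le> B" "B \<ge> 0"
  proof -
    have "compact ((\<lambda>(s, t). k s t) ` ({0..y} \<times> {0..y}))"
      by (intro compact_continuous_image continuous_on_subset[OF k] compact_Times) auto
    then obtain B where "\<forall>x\<in>(\<lambda>(s, t). k s t) ` ({0..y} \<times> {0..y}). norm x \<le> B"
      using compact_imp_bounded bounded_iff by metis
    then show ?thesis by (intro that[of "max B 0"]) force+
  qed
  have FB: "\<bar>F s t\<bar> \<le> indicator {0..y} s * (B * \<bar>h t\<bar>)" for s t
  proof (cases "0 \<le> t \<and> t \<le> s \<and> s \<le> y")
    case True
    then show ?thesis using B(1)[of s t] by (simp add: F_def abs_mult mult_right_mono)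
  qed (use B(2) in \<open>auto simp: F_def indicator_def\<close>)
  have Ft: "integrable lborel (\<lambda>t. F s t)" for s
    by (rule Bochner_Integration.integrable_bound[of _ "\<lambda>t. indicator {0..y} s * (B * \<bar>h t\<bar>)"])
      (use h FB in \<open>auto intro!: AE_I2 integrable_abs intro: order_trans[OF _ abs_ge_self]\<close>)
  have FI: "integrable (lborel \<Otimes>\<^sub>M lborel) (case_prod F)"
  proof (rule lborel_pair.Fubini_integrable)
    show "integrable lborel (\<lambda>s. LINT t|lborel. norm (case_prod F (s, t)))"
    proof (rule Bochner_Integration.integrable_bound)
      show "integrable lborel (\<lambda>s. indicator {0..y} s *\<^sub>R (B * (LINT t|lborel. \<bar>h t\<bar>)))"
        by (intro borel_integrable_compact) auto
      have "(\<lambda>(s, t). norm (F s t)) \<in> borel_measurable (lborel \<Otimes>\<^sub>M lborel)" by measurable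
      from lborel.borel_measurable_lebesgue_integral[OF this]
      show "(\<lambda>s. LINT t|lborel. norm (case_prod F (s, t))) \<in> borel_measurable lborel" by simp
      have "(LINT t|lborel. norm (F s t)) \<le> (LINT t|lborel. indicator {0..y} s * (B * \<bar>h t\<bar>))" for s
      proof (rule integral_mono)
        show "integrable lborel (\<lambda>t. norm (F s t))" by (rule integrable_norm[OF Ft])
        show "integrable lborel (\<lambda>t. indicator {0..y} s * (B * \<bar>h t\<bar>))"
          by (intro integrable_mult_right integrable_abs h)
        show "norm (F s t) \<le> indicator {0..y} s * (B * \<bar>h t\<bar>)" for t using FB by simp
      qed
      then show "AE s in lborel. norm (LINT t|lborel. norm (case_prod F (s, t)))
          \<le> norm (indicator {0..y} s *\<^sub>R (B * (LINT t|lborel. \<bar>h t\<bar>)))"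
        by (intro AE_I2) (auto intro: order_trans[OF _ abs_ge_self])
    qed
    show "AE s in lborel. integrable lborel (\<lambda>t. case_prod F (s, t))" using Ft by simp
    show "case_prod F \<in> borel_measurable (lborel \<Otimes>\<^sub>M lborel)" by measurable
  qed
  have inner: "(LINT t|lborel. F s t) = indicator {0..y} s *\<^sub>R (LINT t:{0..s}|lborel. k s t * f t)" for s
    unfolding set_lebesgue_integral_def F_def h_def
    by (cases "s \<in> {0..y}") (auto intro!: Bochner_Integration.integral_cong integral_eq_zero_AE simp: indicator_def)
  have outer: "(LINT s|lborel. F s t) = indicator {0..y} t *\<^sub>R ((LINT s:{t..y}|lborel. k s t) * f t)" for t
  proof -
    have "(LINT s|lborel. F s t) = (LINT s|lborel. indicator {0..y} t * f t * (indicator {t..y} s * k s t))"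
      unfolding F_def h_def by (rule Bochner_Integration.integral_cong) (auto simp: indicator_def)
    then show ?thesis by (simp add: set_lebesgue_integral_def)
  qed
  show ?eq
    using lborel_pair.Fubini_integral[OF FI]
    unfolding inner outer set_lebesgue_integral_def[of lborel "{0..y}"] by simp
  show ?int
    using lborel_pair.integrable_fst'[OF FI] by (simp add: inner set_integrable_def)
qed

section \<open>Peano kernel of the error functional\<close>

lemma set_integral_FTC:
  fixes F f :: "real \<Rightarrow> real"
  assumes "a \<le> b" "\<And>x. (F has_real_derivative f x) (at x)" "continuous_on UNIV f"
  shows "(LINT x:{a..b}|lborel. f x) = F b - F a"
proof (rule ldom_set_integral)
  show "ldom f" by (rule continuous_imp_ldom[OF assms(3)])
  show "(f has_integral F b - F a) {a..b}"
    by (intro fundamental_theorem_of_calculus assms)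
      (use assms(2) in \<open>auto simp: has_real_derivative_iff_has_vector_derivative has_vector_derivative_at_within\<close>)
qed

lemma ldom_mult_set_integrable:
  assumes c: "ldom c" and f: "set_integrable lborel {a..b} f"
  shows "set_integrable lborel {a..b} (\<lambda>t. c t * f t)"
proof -
  obtain F where F: "continuous_on UNIV F" "\<And>x. \<bar>c x\<bar> \<le> F x" and m[measurable]: "c \<in> borel_measurable borel"
    using c unfolding ldom_def by metis
  have "compact (F ` {a..b})" by (intro compact_continuous_image continuous_on_subset[OF F(1)]) auto
  then obtain B where B: "\<forall>x\<in>F ` {a..b}. norm x \<le> B" using compact_imp_bounded bounded_iff by metis
  define h where "h = (\<lambda>t. indicator {a..b} t *\<^sub>R f t)"
  have h: "integrable lborel h" using f by (simp add: h_def set_integrable_def)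
  then have [measurable]: "h \<in> borel_measurable borel" by (auto dest: borel_measurable_integrable)
  have "integrable lborel (\<lambda>t. c t * h t)"
  proof (rule Bochner_Integration.integrable_bound)
    show "integrable lborel (\<lambda>t. B * h t)" using h by simp
    show "(\<lambda>t. c t * h t) \<in> borel_measurable lborel" by measurable
    have "\<bar>c t * h t\<bar> \<le> \<bar>B * h t\<bar>" for t
    proof (cases "t \<in> {a..b}")
      case True
      then have "\<bar>c t\<bar> \<le> \<bar>B\<bar>" using F(2)[of t] B by force
      then show ?thesis by (simp add: abs_mult mult_right_mono)
    qed (simp add: h_def)
    then show "AE t in lborel. norm (c t * h t) \<le> norm (B * h t)" by simp
  qed
  moreover have "(\<lambda>t. c t * h t) = (\<lambda>t. indicator {a..b} t *\<^sub>R (c t * f t))"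
    by (auto simp: h_def fun_eq_iff)
  ultimately show ?thesis by (simp add: set_integrable_def)
qed

lemma exp_tail_DERIV: "(exp_tail (Suc n) has_real_derivative exp_tail n x) (at x)"
  unfolding exp_tail_def[abs_def] by (intro DERIV_add htail_DERIV)

lemma exp_tail_continuous: "continuous_on A (exp_tail n)"
  unfolding exp_tail_def[abs_def] by (intro continuous_intros htail_continuous)

lemma exp_tail_Suc_0: "exp_tail (Suc n) 0 = 0"
  by (simp only: exp_tail_def htail_Suc_0)

text \<open>\<open>kern n\<close> solves \<open>u\<^sup>(\<^sup>n\<^sup>+\<^sup>1\<^sup>) + u\<^sup>(\<^sup>n\<^sup>) = 0\<close> with \<open>u = \<dots> = u\<^sup>(\<^sup>n\<^sup>-\<^sup>1\<^sup>) = 0\<close> and \<open>u\<^sup>(\<^sup>n\<^sup>) = 1\<close> at \<open>0\<close>.\<close>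
definition kern :: "nat \<Rightarrow> real \<Rightarrow> real" where
  "kern n s = (-1) ^ n * exp_tail n (- s)"

lemma kern_0: "kern 0 s = exp (- s)"
  by (simp add: kern_def exp_tail_0)

lemma kern_Suc_0: "kern (Suc n) 0 = 0"
  by (simp add: kern_def exp_tail_Suc_0)

lemma kern_DERIV: "(kern (Suc n) has_real_derivative kern n s) (at s)"
proof -
  have "((\<lambda>s. exp_tail (Suc n) (- s)) has_real_derivative exp_tail n (- s) * - 1) (at s)"
    by (intro DERIV_chain'[where g = "exp_tail (Suc n)"] exp_tail_DERIV) (auto intro!: derivative_eq_intros)
  from DERIV_cmult[OF this, of "(-1) ^ Suc n"] show ?thesis
    unfolding kern_def[abs_def] by simp
qed

lemma kern_continuous: "continuous_on A f \<Longrightarrow> continuous_on A (\<lambda>x. kern n (f x))"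
  unfolding kern_def
  by (intro continuous_intros continuous_on_compose2[OF exp_tail_continuous[of UNIV]]) auto

lemma kern_set_integral:
  assumes "t \<le> y" shows "(LINT s:{t..y}|lborel. kern n (s - t)) = kern (Suc n) (y - t)"
proof -
  have "((\<lambda>s. kern (Suc n) (s - t)) has_real_derivative kern n (s - t)) (at s)" for s
    using DERIV_shift[of "kern (Suc n)" "kern n (s - t)" s "- t"] kern_DERIV by simp
  from set_integral_FTC[OF assms this] show ?thesis
    by (simp add: kern_continuous continuous_intros kern_Suc_0)
qed

lemma set_integral_cong_pointwise:
  "(\<And>x. x \<in> A \<Longrightarrow> f x = g x) \<Longrightarrow> (LINT x:A|M. f x) = (LINT x:A|M. g x)"
  unfolding set_lebesgue_integral_def
  by (rule Bochner_Integration.integral_cong) (auto simp: indicator_def)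

text \<open>This is the integrated form of (e^t g)' = e^t (g' + g). As g is merely an indefinite
  integral, the product rule comes from exchanging the order of integration.\<close>

lemma exp_weighted_integral:
  fixes g g' :: "real \<Rightarrow> real"
  assumes int: "set_integrable lborel {0..1} g'"
    and g: "\<And>x. x \<in> {0..1} \<Longrightarrow> g x = g 0 + (LINT t:{0..x}|lborel. g' t)"
    and gint: "set_integrable lborel {0..1} g"
    and y: "y \<in> {0..1}"
  shows "g y = g 0 * exp (- y) + (LINT t:{0..y}|lborel. exp (t - y) * (g' t + g t))"
proof -
  have i': "set_integrable lborel {0..y} g'" "set_integrable lborel {0..y} g"
    using y by (auto intro!: set_integrable_subset[OF int] set_integrable_subset[OF gint])
  have ld: "ldom (\<lambda>t. exp (t - y))" by (intro continuous_imp_ldom continuous_intros)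
  have cont: "continuous_on UNIV (\<lambda>(s::real, t::real). exp (s - y))"
    unfolding case_prod_beta by (intro continuous_intros)
  note tri = triangle_Fubini[OF cont i'(1)]
  have e: "(LINT s:{t..y}|lborel. exp (s - y)) = 1 - exp (t - y)" if "t \<le> y" for t
  proof -
    have "((\<lambda>s. exp (s - y)) has_real_derivative exp (s - y)) (at s)" for s
      by (auto intro!: derivative_eq_intros)
    moreover have "continuous_on UNIV (\<lambda>s. exp (s - y))" by (intro continuous_intros)
    ultimately show ?thesis using set_integral_FTC[OF that] by fastforce
  qed
  have "(LINT t:{0..y}|lborel. exp (t - y) * g t)
      = (LINT t:{0..y}|lborel. g 0 * exp (t - y) + (LINT s:{0..t}|lborel. exp (t - y) * g' s))"
  proof (rule set_integral_cong_pointwise)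
    fix t assume "t \<in> {0..y}"
    then have "g t = g 0 + (LINT s:{0..t}|lborel. g' s)" using y by (intro g) auto
    then show "exp (t - y) * g t = g 0 * exp (t - y) + (LINT s:{0..t}|lborel. exp (t - y) * g' s)"
      by (simp add: distrib_left)
  qed
  also have "\<dots> = g 0 * (LINT t:{0..y}|lborel. exp (t - y))
      + (LINT t:{0..y}|lborel. (LINT s:{0..t}|lborel. exp (t - y) * g' s))"
    using tri(2) ldom_set_integrable[OF ld] by (simp add: set_integral_add)
  also have "(LINT t:{0..y}|lborel. (LINT s:{0..t}|lborel. exp (t - y) * g' s))
      = (LINT s:{0..y}|lborel. g' s - exp (s - y) * g' s)"
    unfolding tri(1) by (rule set_integral_cong_pointwise) (auto simp: e algebra_simps)
  also have "\<dots> = (LINT s:{0..y}|lborel. g' s) - (LINT s:{0..y}|lborel. exp (s - y) * g' s)"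
    by (intro set_integral_diff i' ldom_mult_set_integrable ld)
  finally have "(LINT t:{0..y}|lborel. exp (t - y) * g t)
      = g 0 * (1 - exp (- y)) + (g y - g 0) - (LINT s:{0..y}|lborel. exp (s - y) * g' s)"
    using e[of 0] y g[OF y] by simp
  moreover have "(LINT t:{0..y}|lborel. exp (t - y) * (g' t + g t))
      = (LINT t:{0..y}|lborel. exp (t - y) * g' t) + (LINT t:{0..y}|lborel. exp (t - y) * g t)"
    unfolding distrib_left by (intro set_integral_add ldom_mult_set_integrable ld i')
  ultimately show ?thesis by (simp add: algebra_simps)
qed

lemma W_derivs_continuous_integrable:
  "W_derivs m \<phi> g \<Longrightarrow> k < m \<Longrightarrow> set_integrable lborel {0..1} (g k)"
  unfolding set_integrable_def by (intro borel_integrable_compact W_derivs_continuous) auto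

lemma W_derivs_sum_integrable:
  "W_derivs (Suc n) \<phi> g \<Longrightarrow> set_integrable lborel {0..1} (\<lambda>t. g (Suc n) t + g n t)"
  by (intro set_integral_add W_derivs_integrable W_derivs_continuous_integrable) auto

lemma kern_convolution_continuous: "continuous_on UNIV (\<lambda>(s, t). kern k (s - t))"
  unfolding case_prod_beta by (intro kern_continuous continuous_intros)

text \<open>Taylor's formula at 0 for the operator D^k (D + 1): the homogeneous part consists of
  powers below k and \<open>kern k\<close>, the remainder is a convolution with
  \<open>kern k\<close>. Each induction step integrates once from 0 and raises every index by
  one.\<close>

lemma Peano_representation:
  assumes W: "W_derivs (Suc n) \<phi> g" and y: "y \<in> {0..1}" and k: "k \<le> n"
  shows "g (n - k) y = (\<Sum>i<k. g (n - k + i) 0 * mono_fact i y) + g n 0 * kern k y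
      + (LINT t:{0..y}|lborel. kern k (y - t) * (g (Suc n) t + g n t))"
  using k y
proof (induction k arbitrary: y)
  case 0
  then show ?case
    using exp_weighted_integral[OF W_derivs_integrable[OF W lessI] W_derivs_integral[OF W lessI]
        W_derivs_continuous_integrable[OF W lessI], of y]
    by (simp add: kern_0)
next
  case (Suc k)
  define v where "v = (\<lambda>t. g (Suc n) t + g n t)"
  define T where "T = (\<lambda>s. LINT t:{0..s}|lborel. kern k (s - t) * v t)"
  have v: "set_integrable lborel {0..y} v"
    unfolding v_def by (rule set_integrable_subset[OF W_derivs_sum_integrable[OF W]]) (use Suc in auto)
  note tri = triangle_Fubini[OF kern_convolution_continuous v, of k, folded T_def]
  define q where "q = (\<lambda>s. (\<Sum>i<k. g (n - k + i) 0 * mono_fact i s) + g n 0 * kern k s)"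
  have mono_cont: "continuous_on UNIV (mono_fact i)" for i
    unfolding mono_fact_def[abs_def] by (intro continuous_intros) auto
  have qc: "continuous_on UNIV q"
    unfolding q_def using kern_continuous[OF continuous_on_id] by (intro continuous_intros mono_cont) auto
  have qD: "((\<lambda>s. (\<Sum>i<k. g (n - k + i) 0 * mono_fact (Suc i) s) + g n 0 * kern (Suc k) s)
      has_real_derivative q s) (at s)" for s
    unfolding q_def by (intro DERIV_add DERIV_sum DERIV_cmult mono_fact_DERIV kern_DERIV)
  have nk: "Suc (n - Suc k) = n - k" "n - Suc k < Suc n" using Suc.prems by auto
  have "g (n - Suc k) y = g (n - Suc k) 0 + (LINT s:{0..y}|lborel. g (n - k) s)"
    using W_derivs_integral[OF W nk(2) Suc.prems(2)] nk(1) by simp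
  also have "(LINT s:{0..y}|lborel. g (n - k) s) = (LINT s:{0..y}|lborel. q s + T s)"
    by (rule set_integral_cong_pointwise) (use Suc in \<open>auto simp: q_def T_def v_def\<close>)
  also have "\<dots> = (LINT s:{0..y}|lborel. q s) + (LINT s:{0..y}|lborel. T s)"
    by (intro set_integral_add tri(2) ldom_set_integrable continuous_imp_ldom qc)
  also have "(LINT s:{0..y}|lborel. T s) = (LINT t:{0..y}|lborel. kern (Suc k) (y - t) * v t)"
    unfolding tri(1) by (rule set_integral_cong_pointwise) (simp add: kern_set_integral)
  also have "(LINT s:{0..y}|lborel. q s) = (\<Sum>i<k. g (n - k + i) 0 * mono_fact (Suc i) y) + g n 0 * kern (Suc k) y"
    using set_integral_FTC[OF _ qD qc, of 0 y] Suc.prems by (simp add: kern_Suc_0 mono_fact_def)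
  finally have "g (n - Suc k) y = g (n - Suc k) 0 + (\<Sum>i<k. g (n - k + i) 0 * mono_fact (Suc i) y)
      + g n 0 * kern (Suc k) y + (LINT t:{0..y}|lborel. kern (Suc k) (y - t) * v t)" by simp
  moreover have "(\<Sum>i<Suc k. g (n - Suc k + i) 0 * mono_fact i y)
      = g (n - Suc k) 0 + (\<Sum>i<k. g (n - k + i) 0 * mono_fact (Suc i) y)"
    unfolding sum.lessThan_Suc_shift nk(1)[symmetric] by (simp add: mono_fact_def)
  ultimately show ?case by (simp add: v_def)
qed

lemma ell_act_cong:
  assumes "\<forall>\<beta>\<le>N. xs \<beta> \<in> {0..1}" "\<And>x. x \<in> {0..1} \<Longrightarrow> f x = g x"
  shows "ell_act N C xs f = ell_act N C xs g"
  using set_integral_cong_pointwise[of "{0..1}" f g lborel] assms by (simp add: ell_act_def)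

lemma ell_act_add:
  "set_integrable lborel {0..1} f \<Longrightarrow> set_integrable lborel {0..1} g \<Longrightarrow>
    ell_act N C xs (\<lambda>x. f x + g x) = ell_act N C xs f + ell_act N C xs g"
  by (simp add: ell_act_def set_integral_add distrib_left sum.distrib)

lemma ell_act_cmult: "ell_act N C xs (\<lambda>x. c * f x) = c * ell_act N C xs f"
  by (simp add: ell_act_def right_diff_distrib sum_distrib_left mult.left_commute)

lemma ell_act_sum_zero:
  fixes k :: nat
  assumes "\<And>i. i < k \<Longrightarrow> set_integrable lborel {0..1} (f i)" "\<And>i. i < k \<Longrightarrow> ell_act N C xs (f i) = 0"
  shows "ell_act N C xs (\<lambda>x. \<Sum>i<k. c i * f i x) = 0
      \<and> set_integrable lborel {0..1} (\<lambda>x. \<Sum>i<k. c i * f i x)"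
  using assms
proof (induction k)
  case 0
  then show ?case by (simp add: ell_act_def set_integrable_def)
next
  case (Suc k)
  then show ?case by (simp add: ell_act_add ell_act_cmult set_integral_add)
qed

text \<open>Translates vanishing of a convolution into vanishing of the functional. At x = 0 the
  argument is -y: for monomials this costs a sign, and for \<open>exp_tail\<close> it is the
  reflection built into \<open>kern\<close>.\<close>

lemma ell_act_reflected:
  assumes "\<And>x. (F (Suc n) has_real_derivative F n x) (at x)" "continuous_on UNIV (F n)"
  shows "ell_act N C xs (\<lambda>y. F n (x - y)) = ell_conv N C xs F n x"
proof -
  have D: "((\<lambda>y. - F (Suc n) (x - y)) has_real_derivative F n (x - y)) (at y)" for y
  proof -
    have "((\<lambda>y. F (Suc n) (x - y)) has_real_derivative F n (x - y) * - 1) (at y)"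
      by (intro DERIV_chain'[where g = "F (Suc n)"] assms(1)) (auto intro!: derivative_eq_intros)
    from DERIV_minus[OF this] show ?thesis by simp
  qed
  have "continuous_on UNIV (\<lambda>y. F n (x - y))"
    by (intro continuous_on_compose2[OF assms(2)] continuous_intros) auto
  from set_integral_FTC[OF zero_le_one D this] show ?thesis
    by (simp add: ell_act_def ell_conv_def)
qed

text \<open>The error functional applied in \<open>y\<close> to \<open>kern n (y - t)\<close>, cut off to \<open>y \<ge> t\<close>; here \<open>n = m - 1\<close>.\<close>
definition riesz :: "nat \<Rightarrow> nat \<Rightarrow> (nat \<Rightarrow> real) \<Rightarrow> (nat \<Rightarrow> real) \<Rightarrow> real \<Rightarrow> real" where
  "riesz n N C xs t = kern (Suc n) (1 - t)
      - (\<Sum>\<beta>=0..N. C \<beta> * (indicator {..xs \<beta>} t * kern n (xs \<beta> - t)))"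

lemma ldom_indicator_kern: "ldom (\<lambda>t. indicator {..x} t * kern n (x - t))"
  unfolding ldom_def
proof (intro conjI exI allI)
  have c: "continuous_on UNIV (\<lambda>t. kern n (x - t))" by (intro kern_continuous continuous_intros)
  then show "continuous_on UNIV (\<lambda>t. \<bar>kern n (x - t)\<bar>)" by (intro continuous_intros)
  have [measurable]: "(\<lambda>t. kern n (x - t)) \<in> borel_measurable borel" by (rule borel_measurable_continuous_onI[OF c])
  show "(\<lambda>t. indicator {..x} t * kern n (x - t)) \<in> borel_measurable borel" by measurable
qed (auto simp: indicator_def)

lemma ldom_riesz: "ldom (riesz n N C xs)"
proof -
  have "ldom (\<lambda>t. kern (Suc n) (1 - t)
      + (-1) * (\<Sum>\<beta>\<in>{0..N}. C \<beta> * (indicator {..xs \<beta>} t * kern n (xs \<beta> - t))))"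
    by (intro ldom_lincomb ldom_sum ldom_indicator_kern continuous_imp_ldom kern_continuous continuous_intros)
  then show ?thesis by (simp add: riesz_def[abs_def])
qed

text \<open>In the representation of \<phi> with k = n the functional kills the homogeneous part. On
  the remainder its integral part gives \<open>kern (Suc n) (1 - t)\<close> by the exchange of
  integrals, and each node gives a kernel cut off at that node.\<close>

lemma ell_act_riesz:
  assumes W: "W_derivs (Suc n) \<phi> g" and nodes: "\<forall>\<beta>\<le>N. xs \<beta> \<in> {0..1}"
    and mono0: "\<And>k x. k < n \<Longrightarrow> ell_conv N C xs mono_fact k x = 0"
    and E0: "\<And>x. ell_conv N C xs exp_tail n x = 0"
  shows "ell_act N C xs \<phi> = (LINT t:{0..1}|lborel. riesz n N C xs t * (g (Suc n) t + g n t))"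
proof -
  define v where "v = (\<lambda>t. g (Suc n) t + g n t)"
  have v: "set_integrable lborel {0..1} v" unfolding v_def by (rule W_derivs_sum_integrable[OF W])
  define T where "T = (\<lambda>s. LINT t:{0..s}|lborel. kern n (s - t) * v t)"
  note tri = triangle_Fubini[OF kern_convolution_continuous v, of n, folded T_def]
  have mono_cont: "continuous_on UNIV (mono_fact i)" for i
    unfolding mono_fact_def[abs_def] by (intro continuous_intros) auto
  have em: "ell_act N C xs (mono_fact i) = 0" if "i < n" for i
  proof -
    have "mono_fact i = (\<lambda>y. (-1) ^ i * mono_fact i (0 - y))"
      by (simp add: mono_fact_def fun_eq_iff flip: power_mult_distrib)
    then have "ell_act N C xs (mono_fact i) = (-1) ^ i * ell_act N C xs (\<lambda>y. mono_fact i (0 - y))"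
      using ell_act_cmult[of N C xs "(-1) ^ i" "\<lambda>y. mono_fact i (0 - y)"] by simp
    then show ?thesis
      using ell_act_reflected[where F = mono_fact and n = i and x = 0, OF mono_fact_DERIV mono_cont] mono0[OF that] by simp
  qed
  have ek: "ell_act N C xs (kern n) = 0"
    using ell_act_cmult[of N C xs "(-1) ^ n" "\<lambda>y. exp_tail n (0 - y)"]
      ell_act_reflected[where F = exp_tail and n = n and x = 0, OF exp_tail_DERIV exp_tail_continuous] E0
    by (simp add: kern_def[abs_def])
  have ik: "set_integrable lborel {0..1} (\<lambda>y. g n 0 * kern n y)"
    by (intro ldom_set_integrable continuous_imp_ldom continuous_intros kern_continuous)
  have "ell_act N C xs (\<lambda>y. \<Sum>i<n. g i 0 * mono_fact i y) = 0
      \<and> set_integrable lborel {0..1} (\<lambda>y. \<Sum>i<n. g i 0 * mono_fact i y)"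
    by (rule ell_act_sum_zero) (auto intro!: em ldom_set_integrable continuous_imp_ldom mono_cont)
  then have q: "ell_act N C xs (\<lambda>y. \<Sum>i<n. g i 0 * mono_fact i y) = 0"
    "set_integrable lborel {0..1} (\<lambda>y. \<Sum>i<n. g i 0 * mono_fact i y)" by auto
  have "ell_act N C xs \<phi> = ell_act N C xs (\<lambda>y. ((\<Sum>i<n. g i 0 * mono_fact i y) + g n 0 * kern n y) + T y)"
  proof (rule ell_act_cong[OF nodes])
    fix y :: real assume y: "y \<in> {0..1}"
    have "\<phi> y = g 0 y" using W y unfolding W_derivs_def by metis
    then show "\<phi> y = ((\<Sum>i<n. g i 0 * mono_fact i y) + g n 0 * kern n y) + T y"
      using Peano_representation[OF W y order_refl] by (simp add: T_def v_def)
  qed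
  also have "\<dots> = ell_act N C xs T"
    using q ik tri(2) by (simp add: ell_act_add ell_act_cmult ek set_integral_add(1))
  also have "\<dots> = (LINT t:{0..1}|lborel. kern (Suc n) (1 - t) * v t)
      - (\<Sum>\<beta>=0..N. C \<beta> * (LINT t:{0..1}|lborel. indicator {..xs \<beta>} t * kern n (xs \<beta> - t) * v t))"
  proof -
    have "(LINT s:{0..1}|lborel. T s) = (LINT t:{0..1}|lborel. kern (Suc n) (1 - t) * v t)"
      unfolding tri(1) by (rule set_integral_cong_pointwise) (simp add: kern_set_integral)
    moreover have "T (xs \<beta>) = (LINT t:{0..1}|lborel. indicator {..xs \<beta>} t * kern n (xs \<beta> - t) * v t)"
      if "\<beta> \<le> N" for \<beta>
      unfolding T_def set_lebesgue_integral_def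
      by (rule Bochner_Integration.integral_cong) (use nodes that in \<open>force simp: indicator_def\<close>)+
    ultimately show ?thesis by (simp add: ell_act_def)
  qed
  also have "\<dots> = (LINT t:{0..1}|lborel. riesz n N C xs t * v t)"
  proof -
    have i1: "integrable lborel (\<lambda>t. indicator {0..1} t * (kern (Suc n) (1 - t) * v t))"
      using ldom_mult_set_integrable[OF _ v, of "\<lambda>t. kern (Suc n) (1 - t)"]
      by (simp add: set_integrable_def continuous_imp_ldom kern_continuous continuous_intros)
    have i2: "integrable lborel (\<lambda>t. indicator {0..1} t * (indicator {..x} t * kern n (x - t) * v t))" for x
      using ldom_mult_set_integrable[OF ldom_indicator_kern v] by (simp add: set_integrable_def)
    have "indicator {0..1} t * (riesz n N C xs t * v t) = indicator {0..1} t * (kern (Suc n) (1 - t) * v t)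
        - (\<Sum>\<beta>=0..N. C \<beta> * (indicator {0..1} t * (indicator {..xs \<beta>} t * kern n (xs \<beta> - t) * v t)))" for t
      by (simp add: riesz_def algebra_simps sum_distrib_left sum_distrib_right)
    then show ?thesis unfolding set_lebesgue_integral_def real_scaleR_def
      using i1 i2 by (simp only: Bochner_Integration.integral_diff Bochner_Integration.integrable_sum
        Bochner_Integration.integral_sum integrable_mult_right integral_mult_right_zero)
  qed
  finally show ?thesis by (simp add: v_def)
qed

section \<open>Extremality\<close>

lemma ldom_mult:
  assumes "ldom f" "ldom g" shows "ldom (\<lambda>x. f x * g x)"
proof -
  obtain F G where FG: "continuous_on UNIV F" "continuous_on UNIV G"
    "\<And>x. \<bar>f x\<bar> \<le> F x" "\<And>x. \<bar>g x\<bar> \<le> G x" using assms unfolding ldom_def by metis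
  have "\<bar>f x * g x\<bar> \<le> F x * G x" for x
    unfolding abs_mult by (rule mult_mono) (use FG(3,4)[of x] in auto)
  moreover have "continuous_on UNIV (\<lambda>x. F x * G x)" by (intro continuous_intros FG)
  ultimately show ?thesis using assms unfolding ldom_def
    by (auto intro!: exI[of _ "\<lambda>x. F x * G x"])
qed

lemma W_derivs_cmult:
  assumes "W_derivs m \<phi> g" shows "W_derivs m (\<lambda>x. c * \<phi> x) (\<lambda>k x. c * g k x)"
  unfolding W_derivs_def
proof (intro conjI ballI allI impI)
  show "c * g 0 x = c * \<phi> x" if "x \<in> {0..1}" for x
    using assms that unfolding W_derivs_def by metis
  show "set_integrable lborel {0..1} (\<lambda>x. c * g (Suc k) x)" if "k < m" for k
    using W_derivs_integrable[OF assms that] by simp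
  show "c * g k x = c * g k 0 + (LINT t:{0..x}|lborel. c * g (Suc k) t)" if "k < m" "x \<in> {0..1}" for k x
    using arg_cong[OF W_derivs_integral[OF assms that], of "\<lambda>z. c * z"] by (simp add: distrib_left)
  have "set_integrable lborel {0..1} (\<lambda>t. (g m t)\<^sup>2)" using assms unfolding W_derivs_def by blast
  then show "set_integrable lborel {0..1} (\<lambda>t. (c * g m t)\<^sup>2)" by (simp add: power_mult_distrib)
qed

lemma W_derivs_square_integrable:
  assumes W: "W_derivs (Suc n) \<phi> g"
  shows "set_integrable lborel {0..1} (\<lambda>t. (g (Suc n) t + g n t)\<^sup>2)"
proof -
  have sq: "set_integrable lborel {0..1} (\<lambda>t. (g (Suc n) t)\<^sup>2)" using W unfolding W_derivs_def by blast
  have sq': "set_integrable lborel {0..1} (\<lambda>t. (g n t)\<^sup>2)"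
    unfolding set_integrable_def
    by (intro borel_integrable_compact continuous_intros W_derivs_continuous[OF W]) auto
  define v where "v = (\<lambda>t. indicator {0..1} t *\<^sub>R (g (Suc n) t + g n t))"
  have [measurable]: "v \<in> borel_measurable borel"
    using W_derivs_sum_integrable[OF W] by (auto simp: set_integrable_def v_def dest: borel_measurable_integrable)
  have "integrable lborel (\<lambda>t. (v t)\<^sup>2)"
  proof (rule Bochner_Integration.integrable_bound)
    show "integrable lborel (\<lambda>t. 2 * (indicator {0..1} t *\<^sub>R (g (Suc n) t)\<^sup>2) + 2 * (indicator {0..1} t *\<^sub>R (g n t)\<^sup>2))"
      using sq sq' unfolding set_integrable_def by (intro Bochner_Integration.integrable_add integrable_mult_right)
    have "(a + b)\<^sup>2 \<le> 2 * a\<^sup>2 + 2 * b\<^sup>2" for a b :: real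
      using sum_squares_bound[of a b] by (simp add: power2_sum)
    then show "AE t in lborel. norm ((v t)\<^sup>2)
        \<le> norm (2 * (indicator {0..1} t *\<^sub>R (g (Suc n) t)\<^sup>2) + 2 * (indicator {0..1} t *\<^sub>R (g n t)\<^sup>2))"
      by (auto simp: v_def indicator_def)
  qed measurable
  moreover have "(v t)\<^sup>2 = indicator {0..1} t *\<^sub>R (g (Suc n) t + g n t)\<^sup>2" for t
    by (auto simp: v_def indicator_def)
  ultimately show ?thesis by (simp add: set_integrable_def)
qed

text \<open>The integral q of w^2 is both the value of the functional at \<psi> and the squared norm
  of \<psi>; for nonzero q it remains to see that the dual norm is the square root of q.\<close>

lemma extremal_fn_of_riesz:
  assumes W: "W_derivs (Suc n) \<psi> g" and w: "ldom w"
    and ae: "AE t in lborel. t \<in> {0..1} \<longrightarrow> g (Suc n) t + g n t = w t"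
    and rep: "\<And>\<phi> h. W_derivs (Suc n) \<phi> h \<Longrightarrow>
      ell_act N C xs \<phi> = (LINT t:{0..1}|lborel. w t * (h (Suc n) t + h n t))"
  shows "extremal_fn (Suc n) N C xs \<psi>"
proof -
  define q where "q = (LINT t:{0..1}|lborel. (w t)\<^sup>2)"
  have w2: "set_integrable lborel {0..1} (\<lambda>t. (w t)\<^sup>2)"
    using ldom_set_integrable[OF ldom_mult[OF w w]] by (simp add: power2_eq_square)
  have q0: "q \<ge> 0" unfolding q_def set_lebesgue_integral_def by (rule Bochner_Integration.integral_nonneg) simp
  have v: "set_integrable lborel {0..1} (\<lambda>t. g (Suc n) t + g n t)" by (rule W_derivs_sum_integrable[OF W])
  have "(LINT t:{0..1}|lborel. w t * (g (Suc n) t + g n t)) = q"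
    unfolding q_def set_lebesgue_integral_def
  proof (rule integral_cong_AE)
    show "(\<lambda>t. indicator {0..1} t *\<^sub>R (w t * (g (Suc n) t + g n t))) \<in> borel_measurable lborel"
      using ldom_mult_set_integrable[OF w v] by (auto simp: set_integrable_def)
    show "(\<lambda>t. indicator {0..1} t *\<^sub>R (w t)\<^sup>2) \<in> borel_measurable lborel"
      using w2 by (auto simp: set_integrable_def)
    show "AE t in lborel. indicator {0..1} t *\<^sub>R (w t * (g (Suc n) t + g n t)) = indicator {0..1} t *\<^sub>R (w t)\<^sup>2"
      using ae by eventually_elim (auto simp: indicator_def power2_eq_square)
  qed
  then have act: "ell_act N C xs \<psi> = q" using rep[OF W] by simp
  have "(LINT t:{0..1}|lborel. (g (Suc n) t + g n t)\<^sup>2) = q"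
    unfolding q_def set_lebesgue_integral_def
  proof (rule integral_cong_AE)
    show "(\<lambda>t. indicator {0..1} t *\<^sub>R (g (Suc n) t + g n t)\<^sup>2) \<in> borel_measurable lborel"
      using W_derivs_square_integrable[OF W] by (auto simp: set_integrable_def)
    show "(\<lambda>t. indicator {0..1} t *\<^sub>R (w t)\<^sup>2) \<in> borel_measurable lborel"
      using w2 by (auto simp: set_integrable_def)
    show "AE t in lborel. indicator {0..1} t *\<^sub>R (g (Suc n) t + g n t)\<^sup>2 = indicator {0..1} t *\<^sub>R (w t)\<^sup>2"
      using ae by eventually_elim (auto simp: indicator_def)
  qed
  then have norm: "W_norm (Suc n) \<psi> = sqrt q" using W_norm_eq[OF W] by simp
  have inW: "in_W (Suc n) \<psi>" using W by (auto simp: in_W_def)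
  \<comment> \<open>For q = 0 the norm of \<psi> is 0, and in \<open>ereal\<close> any factor, even
    an infinite one, times 0 is 0.\<close>
  have "ereal q = ell_norm (Suc n) N C xs * ereal (sqrt q)"
  proof (cases "q = 0")
    case False
    then have s0: "sqrt q > 0" using q0 by simp
    have "ell_norm (Suc n) N C xs = ereal (sqrt q)"
      unfolding ell_norm_def
    proof (intro antisym SUP_least)
      fix \<phi> assume "\<phi> \<in> {\<phi>. in_W (Suc n) \<phi> \<and> W_norm (Suc n) \<phi> = 1}"
      then obtain h where h: "W_derivs (Suc n) \<phi> h" and n1: "W_norm (Suc n) \<phi> = 1" by (auto simp: in_W_def)
      define v where "v = (\<lambda>t. h (Suc n) t + h n t)"
      have v1: "(LINT t:{0..1}|lborel. (v t)\<^sup>2) = 1"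
        using W_norm_eq[OF h] n1 by (simp add: v_def)
      have v2: "set_integrable lborel {0..1} (\<lambda>t. (v t)\<^sup>2)"
        unfolding v_def by (rule W_derivs_square_integrable[OF h])
      have wv: "set_integrable lborel {0..1} (\<lambda>t. w t * v t)"
        unfolding v_def by (intro ldom_mult_set_integrable w W_derivs_sum_integrable[OF h])
      \<comment> \<open>Cauchy-Schwarz as a weighted arithmetic-geometric mean inequality. With the
        integrals 1 of v^2 and q of w^2, this weight makes the two terms equal to
        \<open>sqrt q / 2\<close> each.\<close>
      have pt: "\<bar>x * y\<bar> \<le> sqrt q / 2 * y\<^sup>2 + 1 / (2 * sqrt q) * x\<^sup>2" for x y :: real
      proof -
        have "0 \<le> (\<bar>x\<bar> - sqrt q * \<bar>y\<bar>)\<^sup>2" by simp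
        then have "2 * sqrt q * \<bar>x * y\<bar> \<le> x\<^sup>2 + (sqrt q)\<^sup>2 * y\<^sup>2"
          by (simp add: power2_diff power_mult_distrib abs_mult algebra_simps del: real_sqrt_pow2)
        then show ?thesis using s0 by (simp add: field_simps power2_eq_square)
      qed
      have ib: "integrable lborel (\<lambda>t. indicator {0..1} t *\<^sub>R (w t * v t))"
        "integrable lborel (\<lambda>t. indicator {0..1} t *\<^sub>R (v t)\<^sup>2)"
        "integrable lborel (\<lambda>t. indicator {0..1} t *\<^sub>R (w t)\<^sup>2)"
        using wv v2 w2 by (simp_all add: set_integrable_def)
      have "\<bar>LINT t:{0..1}|lborel. w t * v t\<bar> \<le> (LINT t|lborel. \<bar>indicator {0..1} t *\<^sub>R (w t * v t)\<bar>)"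
        unfolding set_lebesgue_integral_def by (rule integral_abs_bound)
      also have "\<dots> \<le> (LINT t|lborel. sqrt q / 2 * (indicator {0..1} t *\<^sub>R (v t)\<^sup>2)
          + 1 / (2 * sqrt q) * (indicator {0..1} t *\<^sub>R (w t)\<^sup>2))"
        using pt by (intro integral_mono Bochner_Integration.integrable_add integrable_mult_right integrable_abs ib)
          (auto simp: indicator_def)
      also have "\<dots> = sqrt q / 2 * 1 + 1 / (2 * sqrt q) * q"
        unfolding Bochner_Integration.integral_add[OF integrable_mult_right[OF ib(2)] integrable_mult_right[OF ib(3)]]
          integral_mult_right_zero
        using v1 by (simp only: q_def set_lebesgue_integral_def)
      also have "\<dots> = sqrt q"
      proof -
        have "q / sqrt q = sqrt q" by (simp add: real_div_sqrt q0)
        then show ?thesis by simp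
      qed
      finally show "ereal \<bar>ell_act N C xs \<phi>\<bar> \<le> ereal (sqrt q)"
        using rep[OF h] by (simp add: v_def)
    next
      \<comment> \<open>Normalizing \<psi> by its norm \<open>sqrt q\<close> gives an element of the
        unit sphere at which the bound is attained.\<close>
      let ?c = "1 / sqrt q"
      have Wc: "W_derivs (Suc n) (\<lambda>x. ?c * \<psi> x) (\<lambda>k x. ?c * g k x)" by (rule W_derivs_cmult[OF W])
      have "(LINT t:{0..1}|lborel. (?c * g (Suc n) t + ?c * g n t)\<^sup>2)
          = (LINT t:{0..1}|lborel. ?c\<^sup>2 * (g (Suc n) t + g n t)\<^sup>2)"
        by (simp only: distrib_left[symmetric] power_mult_distrib)
      also have "\<dots> = ?c\<^sup>2 * q"
        using \<open>(LINT t:{0..1}|lborel. (g (Suc n) t + g n t)\<^sup>2) = q\<close> by (simp only: set_integral_mult_right)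
      also have "\<dots> = 1" using False q0 by (simp add: power_divide)
      finally have "W_norm (Suc n) (\<lambda>x. ?c * \<psi> x) = 1" using W_norm_eq[OF Wc] by simp
      moreover have "in_W (Suc n) (\<lambda>x. ?c * \<psi> x)" using Wc unfolding in_W_def by blast
      moreover have "ell_act N C xs (\<lambda>x. ?c * \<psi> x) = sqrt q"
        unfolding ell_act_cmult act using q0 by (simp add: real_div_sqrt)
      ultimately show "ereal (sqrt q) \<le> (SUP \<phi>\<in>{\<phi>. in_W (Suc n) \<phi> \<and> W_norm (Suc n) \<phi> = 1}. ereal \<bar>ell_act N C xs \<phi>\<bar>)"
        using q0 by (intro SUP_upper2[of "\<lambda>x. ?c * \<psi> x"]) auto
    qed
    then show ?thesis using q0 by simp
  qed (simp add: zero_ereal_def[symmetric])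
  then show ?thesis using inW act norm by (simp add: extremal_fn_def)
qed

section \<open>Derivatives of the solution inside the unit interval\<close>

lemma ell_conv_sgn_tail_DERIV:
  assumes "x \<notin> insert 0 (insert 1 (xs ` {0..N}))"
  shows "(ell_conv N C xs sgn_tail (Suc n) has_real_derivative ell_conv N C xs sgn_tail n x) (at x)"
  unfolding ell_conv_def[abs_def] using assms sgn_tail_shift_DERIV[of x 0]
  by (intro DERIV_diff DERIV_sum DERIV_cmult sgn_tail_shift_DERIV) auto

lemma ldom_ell_conv_S: "ldom (ell_conv N C xs sgn_tail n)"
proof -
  have "ldom (\<lambda>x. sgn_tail (Suc n) (x - 0) + (-1) * sgn_tail (Suc n) (x - 1) + (-1) * (\<Sum>\<beta>\<in>{0..N}. C \<beta> * sgn_tail n (x - xs \<beta>)))"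
    by (intro ldom_lincomb ldom_sgn_tail_shift ldom_sum)
  then show ?thesis by (simp add: ell_conv_def[abs_def])
qed

text \<open>The derivatives of \<psi> after the e^x term has been ruled out. For k < m the
  \<open>sgn_tail\<close> index is at least m, so these entries are continuous; at k = m it is m -
  1, which for m = 1 permits jumps.\<close>

definition inner_derivs ::
  "nat \<Rightarrow> nat \<Rightarrow> (nat \<Rightarrow> real) \<Rightarrow> (nat \<Rightarrow> real) \<Rightarrow> real poly \<Rightarrow> real \<Rightarrow> nat \<Rightarrow> real \<Rightarrow> real" where
  "inner_derivs m N C xs p b k x = (-1) ^ m * ell_conv N C xs sgn_tail (2*m - 1 - k) x
      + poly ((pderiv ^^ k) p) x + (-1) ^ k * b * exp (- x)"

lemma ldom_inner_derivs: "ldom (inner_derivs m N C xs p b k)"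
proof -
  have "ldom (\<lambda>x. (poly ((pderiv ^^ k) p) x + (-1) ^ k * b * exp (- x)) + (-1) ^ m * ell_conv N C xs sgn_tail (2*m - 1 - k) x)"
    by (intro ldom_lincomb ldom_ell_conv_S continuous_imp_ldom continuous_intros)
  then show ?thesis by (simp add: inner_derivs_def[abs_def] add_ac)
qed

lemma W_derivs_inner_derivs:
  assumes m: "m \<ge> 1" and \<psi>: "\<And>x. \<psi> x = inner_derivs m N C xs p b 0 x"
  shows "W_derivs m \<psi> (inner_derivs m N C xs p b)"
  unfolding W_derivs_def
proof (intro conjI ballI allI impI)
  let ?g = "inner_derivs m N C xs p b"
  show "?g 0 x = \<psi> x" for x by (simp add: \<psi>)
  show "set_integrable lborel {0..1} (?g (Suc k))" for k
    by (rule ldom_set_integrable[OF ldom_inner_derivs])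
  show "set_integrable lborel {0..1} (\<lambda>t. (?g m t)\<^sup>2)"
    unfolding power2_eq_square by (intro ldom_set_integrable ldom_mult ldom_inner_derivs)
  show "?g k x = ?g k 0 + (LINT t:{0..x}|lborel. ?g (Suc k) t)" if k: "k < m" and x: "x \<in> {0..1}" for k x
  proof -
    have idx: "2*m - 1 - k = Suc (2*m - 1 - Suc k)" using k by auto
    have "(?g (Suc k) has_integral ?g k x - ?g k 0) {0..x}"
    proof (rule fundamental_theorem_of_calculus_interior_strong)
      show "finite (insert 0 (insert 1 (xs ` {0..N})))" by simp
      show "continuous_on {0..x} (?g k)"
        unfolding inner_derivs_def by (intro continuous_intros ell_conv_sgn_tail_continuous) (use k in linarith)
      show "(?g k has_vector_derivative ?g (Suc k) t) (at t)"
        if "t \<in> {0<..<x} - insert 0 (insert 1 (xs ` {0..N}))" for t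
      proof -
        have "(ell_conv N C xs sgn_tail (2*m - 1 - k) has_real_derivative ell_conv N C xs sgn_tail (2*m - 1 - Suc k) t) (at t)"
          unfolding idx by (rule ell_conv_sgn_tail_DERIV) (use that in auto)
        then show ?thesis
          unfolding has_real_derivative_iff_has_vector_derivative[symmetric] inner_derivs_def
          by (auto intro!: derivative_eq_intros poly_DERIV)
      qed
    qed (use x in auto)
    then have "(LINT t:{0..x}|lborel. ?g (Suc k) t) = ?g k x - ?g k 0"
      by (intro ldom_set_integral ldom_inner_derivs)
    then show ?thesis by simp
  qed
qed

lemma inner_derivs_eq_riesz:
  assumes p: "(pderiv ^^ n) p = 0"
    and E0: "ell_conv N C xs exp_tail n t = 0" and t: "t \<in> {0..1} - insert 0 (insert 1 (xs ` {0..N}))"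
  shows "inner_derivs (Suc n) N C xs p b (Suc n) t + inner_derivs (Suc n) N C xs p b n t = riesz n N C xs t"
proof -
  have SE: "sgn_tail (Suc k) x + sgn_tail k x = sgn x / 2 * exp_tail k x" for k x by (simp add: sgn_tail_def exp_tail_def algebra_simps)
  have "inner_derivs (Suc n) N C xs p b (Suc n) t + inner_derivs (Suc n) N C xs p b n t
      = (-1) ^ Suc n * (ell_conv N C xs sgn_tail (Suc n) t + ell_conv N C xs sgn_tail n t)"
  proof -
    have "2 * Suc n - 1 - Suc n = n" "2 * Suc n - 1 - n = Suc n" by auto
    then show ?thesis unfolding inner_derivs_def using p by (simp add: algebra_simps)
  qed
  also have "ell_conv N C xs sgn_tail (Suc n) t + ell_conv N C xs sgn_tail n t
      = (sgn_tail (Suc (Suc n)) t + sgn_tail (Suc n) t) - (sgn_tail (Suc (Suc n)) (t - 1) + sgn_tail (Suc n) (t - 1))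
        - (\<Sum>\<beta>=0..N. C \<beta> * (sgn_tail (Suc n) (t - xs \<beta>) + sgn_tail n (t - xs \<beta>)))"
    unfolding ell_conv_def distrib_left sum.distrib by simp
  also have "\<dots> = 1/2 * exp_tail (Suc n) t + 1/2 * exp_tail (Suc n) (t - 1) - (\<Sum>\<beta>=0..N. C \<beta> * (sgn (t - xs \<beta>) / 2 * exp_tail n (t - xs \<beta>)))"
    using t unfolding SE by (auto simp: sgn_real_def)
  \<comment> \<open>Subtracting half of the vanishing convolution replaces sgn/2 by (sgn - 1)/2,
    which is -1 to the left of a node and 0 to the right. The symmetric kernel thus becomes the
    one-sided kernel of \<open>riesz\<close>.\<close>
  also have "\<dots> = (1/2 * exp_tail (Suc n) t + 1/2 * exp_tail (Suc n) (t - 1) - (\<Sum>\<beta>=0..N. C \<beta> * (sgn (t - xs \<beta>) / 2 * exp_tail n (t - xs \<beta>))))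
      - 1/2 * ell_conv N C xs exp_tail n t" using E0 by simp
  also have "\<dots> = exp_tail (Suc n) (t - 1)
      - ((\<Sum>\<beta>=0..N. C \<beta> * (sgn (t - xs \<beta>) / 2 * exp_tail n (t - xs \<beta>))) - (\<Sum>\<beta>=0..N. 1/2 * (C \<beta> * exp_tail n (t - xs \<beta>))))"
    unfolding ell_conv_def sum_distrib_left[symmetric] by (simp add: algebra_simps)
  also have "\<dots> = exp_tail (Suc n) (t - 1)
      + (\<Sum>\<beta>=0..N. C \<beta> * (indicator {..xs \<beta>} t * exp_tail n (t - xs \<beta>)))"
  proof -
    have "C \<beta> * (sgn (t - xs \<beta>) / 2 * exp_tail n (t - xs \<beta>)) - 1/2 * (C \<beta> * exp_tail n (t - xs \<beta>))
        = - (C \<beta> * (indicator {..xs \<beta>} t * exp_tail n (t - xs \<beta>)))" if "\<beta> \<in> {0..N}" for \<beta>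
    proof -
      have "t \<noteq> xs \<beta>" using t that by auto
      then show ?thesis by (auto simp: sgn_real_def indicator_def)
    qed
    then show ?thesis unfolding sum_subtractf[symmetric] by (simp add: sum_negf)
  qed
  finally show ?thesis
    by (simp add: riesz_def kern_def algebra_simps sum_distrib_left sum_negf)
qed

text \<open>A distributional equation fixes a function only almost everywhere; continuity selects
  the representative for which the formula holds at every point. The form
  \<open>degree P + 2 \<le> m\<close> avoids truncated subtraction, so m = 1 leaves only
  \<open>P = 0\<close>.\<close>

theorem theorem2p1:
  fixes m N :: nat and C xs :: "nat \<Rightarrow> real" and \<psi> :: "real \<Rightarrow> real"
  assumes m_pos: "m \<ge> 1"
    and nodes: "\<forall>\<beta>\<le>N. xs \<beta> \<in> {0..1}"
    and cont: "continuous_on UNIV \<psi>"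
    and ode: "dist_solves m \<psi> (\<lambda>\<phi>. (-1) ^ m * ell_act N C xs \<phi>)"
    and bc1: "\<forall>s\<in>{1..m-1}. vanishes_at_ends
                 (\<lambda>t. (deriv ^^ (m + s)) \<psi> t - (deriv ^^ (m + s - 2)) \<psi> t)"
    and bc2: "vanishes_at_ends (\<lambda>t. (deriv ^^ m) \<psi> t + (deriv ^^ (m - 1)) \<psi> t)"
  shows "extremal_fn m N C xs \<psi>
         \<and> (\<exists>P :: real poly. \<exists>d :: real. (P = 0 \<or> degree P + 2 \<le> m)
              \<and> (\<forall>x. \<psi> x = (-1) ^ m * ell_conv_G m N C xs x + poly P x + d * exp (- x)))
         \<and> dist_solves m (G m) (\<lambda>\<phi>. \<phi> 0)"
proof -
  obtain n where m: "m = Suc n" using m_pos by (cases m) auto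
  obtain p a b where \<psi>: "\<And>x. \<psi> x = (-1) ^ m * ell_conv N C xs sgn_tail (2*m - 1) x + poly p x + a * exp x + b * exp (- x)"
    and deg: "p = 0 \<or> degree p < 2*m - 2"
    using general_solution[OF m_pos cont ode] by blast
  note bc = boundary_consequences[OF m nodes \<psi> deg bc1 bc2]
  have \<psi>': "\<psi> x = inner_derivs m N C xs p b 0 x" for x
    unfolding \<psi> inner_derivs_def using bc(2) by simp
  have W: "W_derivs (Suc n) \<psi> (inner_derivs (Suc n) N C xs p b)"
    using W_derivs_inner_derivs[OF m_pos \<psi>'] m by simp
  have "extremal_fn (Suc n) N C xs \<psi>"
  proof (rule extremal_fn_of_riesz[OF W ldom_riesz])
    have "AE t in lborel. t \<notin> insert 0 (insert 1 (xs ` {0..N}))"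
      by (intro AE_not_in finite_imp_null_set_lborel) simp
    then show "AE t in lborel. t \<in> {0..1} \<longrightarrow>
        inner_derivs (Suc n) N C xs p b (Suc n) t + inner_derivs (Suc n) N C xs p b n t = riesz n N C xs t"
      by eventually_elim
        (use inner_derivs_eq_riesz bc(1,4) in \<open>simp add: pderiv_funpow_eq_0_iff\<close>)
    show "ell_act N C xs \<phi> = (LINT t:{0..1}|lborel. riesz n N C xs t * (h (Suc n) t + h n t))"
      if "W_derivs (Suc n) \<phi> h" for \<phi> h
      by (rule ell_act_riesz[OF that nodes bc(3) bc(4)]) auto
  qed
  moreover have "\<psi> x = (-1) ^ m * ell_conv_G m N C xs x + poly p x + b * exp (- x)" for x
    unfolding \<psi> ell_conv_G_eq[OF m_pos] using bc(2) by simp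
  moreover have "p = 0 \<or> degree p + 2 \<le> m" using bc(1) m by auto
  ultimately show ?thesis using dist_solves_G[OF m_pos] m by blast
qed

end
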